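(* Let $d\geq2$ and let $K\subset\mathbb R^d$ be a set that satisfies the following conditions: (i) $K$ is compact and $0<\mathcal H_d(K)<\infty$; (ii) $K=\operatorname{clos}(K_0)$, where $K_0$ is an open set in $\mathbb R^d$ with $\partial K_0=\partial K$; (iii) the boundary $\partial K$ of $K$ is a $C^2$ smooth $(d-1)$-dimensional embedded submanifold of $\mathbb R^d$. Let $X_N=\{x_1,\dots,x_N\}$ be a set of $N$ points, independently and randomly distributed over $K$ with respect to $\mathrm d\mu=\mathbf 1_K\cdot\mathrm d\mathcal H_d/\mathcal H_d(K)$. Then for any $p\geq1$ $$\lim_{N\to\infty}\mathbb E[\rho(X_N,K)^p]\cdot\left[\frac{N}{\log N}\right]^{p/d}=\left(\frac{2(d-1)}{d}\cdot\frac{\mathcal H_d(K)}{\upsilon_d}\right)^{p/d}.$$ In particular, for the closed unit ball $B_d(0,1)\subset\mathbb R^d$, $$\lim_{N\to\infty}\mathbb E[\rho(X_N,B_d(0,1))^p]\cdot\left[\frac{N}{\log N}\right]^{p/d}=\left(\frac{2(d-1)}{d}\right)^{p/d}.$$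
   Context: $\mathcal H_d$ is $d$-dimensional Hausdorff measure on $\mathbb R^d$ normalized by $\mathcal H_d([0,1]^d)=1$ (i.e. Lebesgue measure); $\upsilon_d=\pi^{d/2}/\Gamma(1+d/2)$ is the volume of the unit ball in $\mathbb R^d$. The covering radius is $\rho(X_N,K):=\sup_{y\in K}\min_j|y-x_j|$ (Euclidean distance). *)

theory Defs
  imports "HOL-Probability.Probability"
begin

(* Meant for open S: the two derivatives are full (Frechet) derivatives. *)
definition C2_on :: "'a::real_normed_vector set \<Rightarrow> ('a \<Rightarrow> 'b::real_normed_vector) \<Rightarrow> bool" where
  "C2_on S f \<longleftrightarrow>
     (\<exists>(f' :: 'a \<Rightarrow> 'a \<Rightarrow>\<^sub>L 'b) (f'' :: 'a \<Rightarrow> 'a \<Rightarrow>\<^sub>L ('a \<Rightarrow>\<^sub>L 'b)).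
        (\<forall>x\<in>S. (f has_derivative blinfun_apply (f' x)) (at x)) \<and>
        (\<forall>x\<in>S. (f' has_derivative blinfun_apply (f'' x)) (at x)) \<and>
        continuous_on S f'')"

(* Slice charts: around each of its points, M is carried onto a relatively open piece of a
   k-dimensional linear subspace by a C^2 diffeomorphism between open subsets of the ambient space. *)
definition C2_embedded_submanifold :: "nat \<Rightarrow> 'a::euclidean_space set \<Rightarrow> bool" where
  "C2_embedded_submanifold k M \<longleftrightarrow>
     (\<forall>q\<in>M. \<exists>(U :: 'a set) (V :: 'a set) \<phi> \<psi> S.
        open U \<and> open V \<and> q \<in> U \<and>
        homeomorphism U V \<phi> \<psi> \<and> C2_on U \<phi> \<and> C2_on V \<psi> \<and>
        subspace S \<and> dim S = k \<and> \<phi> ` (U \<inter> M) = V \<inter> S)"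

(* The points are x 0, ..., x (N - 1).  For N = 0 the value is irrelevant (Min of the empty set). *)
definition covering_radius :: "(nat \<Rightarrow> 'a::metric_space) \<Rightarrow> nat \<Rightarrow> 'a set \<Rightarrow> real" where
  "covering_radius x N K = (SUP y\<in>K. Min ((\<lambda>j. dist y (x j)) ` {..<N}))"

(* X 0, ..., X (N - 1) are random points on the probability space P, independent, each with the
   normalized restriction of Lebesgue measure to K as its law. *)
definition iid_uniform_points ::
  "'w measure \<Rightarrow> (nat \<Rightarrow> 'w \<Rightarrow> 'a::euclidean_space) \<Rightarrow> nat \<Rightarrow> 'a set \<Rightarrow> bool" where
  "iid_uniform_points P X N K \<longleftrightarrow>
     prob_space P \<and>
     prob_space.indep_vars P (\<lambda>_. borel) X {..<N} \<and>
     (\<forall>i<N. distr P borel (X i) = uniform_measure lborel K)"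

end

theory Submission
  imports Defs "HOL-Real_Asymp.Real_Asymp"
begin

text \<open>
Write $d$ for the dimension, $v$ for the volume of the unit ball and $H$ for the volume of $K$, and
look at radii $r = (c \cdot \log N / N)^{1/d}$. A ball of radius $r$ inside $K$ contains none of the $N$ points
with probability about $\exp(-N v r^d / H) = N^{-cv/H}$. A ball centred on the boundary loses
half of its volume, because a smooth boundary looks like a hyperplane at small scales; it is empty
with the much larger probability $N^{-cv/(2H)}$. On the other hand the boundary is small: it
needs only about $r^{-(d-1)}$ balls of radius $r$, against $r^{-d}$ for all of $K$. Up to logarithms
the expected number of empty balls is therefore $N^{(d-1)/d - cv/(2H)}$ at the boundary
and $N^{1 - cv/H}$ inside. The first exponent changes sign at $c^* = (2(d-1)/d) \cdot H/v$, the second one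
at $H/v$, and $c^*$ is at least $H/v$ because $d$ is at least 2: the boundary decides.

Above $c^*$ a union bound over a fine net of both kinds of balls shows that the covering radius exceeds $r$
with probability tending to 0 (\<open>prob_covering_radius_gt\<close>). Below $c^*$ one takes disjoint balls centred on
the boundary: their expected number of empty members tends to infinity, the events are
negatively correlated, and the second moment method yields an empty ball, hence a covering
radius of at least $r$, with probability tending to 1 (\<open>prob_covering_radius_lt\<close>).

So the covering radius divided by $(\log N / N)^{1/d}$ converges to $(c^*)^{1/d}$ in probability.
For convergence of the $p$-th moments the upper tail has to be controlled as well. For $c$ slightly above $c^*$
the tail probability may tend to 0 so slowly that it does not compensate the trivial bound by
the diameter of $K$; but for a large constant $c'$ it is smaller than any prescribed
power of $N$. Splitting the expectation at these two radii gives the limit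
(\<open>covering_radius_moment_limit\<close>).

The geometric input is twofold. Charts of the boundary have a derivative that is continuous, so
near each of its points the boundary lies in thin slabs parallel to one fixed hyperplane, and
$K$ fills exactly one side of them (\<open>frontier_flat\<close>); this gives the volumes. Charts are also bi-Lipschitz near each
point, so covering and packing numbers of the boundary are those of a subspace of
dimension $d-1$. For the unit ball, the sphere is a hypersurface in the required sense through an
inversion, which straightens it into a hyperplane.
\<close>

section \<open>Flatness of a smooth boundary at small scales\<close>

text \<open>
Strict differentiability: the linear approximation at \<open>q\<close> controls differences between any two points near \<open>q\<close>,
because the derivative is continuous. This is the only way in which smoothness enters the
analysis of the boundary; the uniformity in both points is what makes the later estimates uniform.
\<close>
lemma C2_on_linearization:
  fixes f :: "'a::real_normed_vector \<Rightarrow> 'b::real_normed_vector"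
  assumes "C2_on U f" "open U" "q \<in> U"
  obtains D where "(f has_derivative D) (at q)"
    and "\<And>e. e > 0 \<Longrightarrow> \<exists>\<delta>>0. ball q \<delta> \<subseteq> U \<and>
           (\<forall>x\<in>ball q \<delta>. \<forall>y\<in>ball q \<delta>. norm (f x - f y - D (x - y)) \<le> e * norm (x - y))"
proof -
  obtain f' :: "'a \<Rightarrow> 'a \<Rightarrow>\<^sub>L 'b" and f''
    where d1: "\<And>x. x \<in> U \<Longrightarrow> (f has_derivative blinfun_apply (f' x)) (at x)"
      and d2: "\<And>x. x \<in> U \<Longrightarrow> (f' has_derivative blinfun_apply (f'' x)) (at x)"
    using assms(1) unfolding C2_on_def by blast
  have cont: "isCont f' q"
    using d2[OF assms(3)] has_derivative_continuous by blast
  have "\<exists>\<delta>>0. ball q \<delta> \<subseteq> U \<and>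
          (\<forall>x\<in>ball q \<delta>. \<forall>y\<in>ball q \<delta>. norm (f x - f y - f' q (x - y)) \<le> e * norm (x - y))"
    if "e > 0" for e
  proof -
    obtain d where d: "d > 0" "\<And>x. dist x q < d \<Longrightarrow> dist (f' x) (f' q) < e"
      using cont \<open>e > 0\<close> unfolding continuous_at_eps_delta by blast
    obtain r where r: "r > 0" "ball q r \<subseteq> U"
      using assms open_contains_ball by blast
    define s where "s = min d r"
    have s: "s > 0" "ball q s \<subseteq> U" using d r by (auto simp: s_def)
    have "norm (f x - f y - f' q (x - y)) \<le> norm (x - y) * e"
      if xy: "x \<in> ball q s" "y \<in> ball q s" for x y
    proof (rule differentiable_bound_linearization[where S = "ball q s" and f' = "\<lambda>x. blinfun_apply (f' x)"])
      show "y + t *\<^sub>R (x - y) \<in> ball q s" if "t \<in> {0..1}" for t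
      proof -
        have "(1 - t) *\<^sub>R y + t *\<^sub>R x \<in> ball q s"
          using that xy convex_ball[of q s] unfolding convex_alt by auto
        then show ?thesis by (simp add: algebra_simps)
      qed
      show "(f has_derivative blinfun_apply (f' z)) (at z within ball q s)" if "z \<in> ball q s" for z
        using d1 s(2) that has_derivative_at_withinI by blast
      show "onorm (blinfun_apply (f' z) - blinfun_apply (f' q)) \<le> e" if "z \<in> ball q s" for z
      proof -
        have "norm (f' z - f' q) \<le> e"
          using d(2)[of z] that by (simp add: s_def dist_norm norm_minus_commute)
        moreover have "blinfun_apply (f' z) - blinfun_apply (f' q) = blinfun_apply (f' z - f' q)"
          by (rule ext) (simp add: blinfun.diff_left)
        ultimately show ?thesis by (simp add: norm_blinfun.rep_eq)
      qed
      show "q \<in> ball q s" using s by simp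
    qed
    then show ?thesis using s by (auto simp: mult.commute)
  qed
  with d1[OF assms(3)] show ?thesis using that by blast
qed

lemma C2_on_lipschitz:
  fixes f :: "'a::real_normed_vector \<Rightarrow> 'b::real_normed_vector"
  assumes "C2_on U f" "open U" "q \<in> U"
  obtains L \<delta> where "L > 0" "\<delta> > 0" "ball q \<delta> \<subseteq> U"
    and "\<And>x y. x \<in> ball q \<delta> \<Longrightarrow> y \<in> ball q \<delta> \<Longrightarrow> dist (f x) (f y) \<le> L * dist x y"
proof -
  obtain D where D: "(f has_derivative D) (at q)"
    and lin: "\<And>e. e > 0 \<Longrightarrow> \<exists>\<delta>>0. ball q \<delta> \<subseteq> U \<and>
           (\<forall>x\<in>ball q \<delta>. \<forall>y\<in>ball q \<delta>. norm (f x - f y - D (x - y)) \<le> e * norm (x - y))"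
    using C2_on_linearization[OF assms] by blast
  obtain B where B: "B > 0" "\<And>x. norm (D x) \<le> norm x * B"
    using has_derivative_bounded_linear[OF D] bounded_linear.pos_bounded by blast
  obtain \<delta> where \<delta>: "\<delta> > 0" "ball q \<delta> \<subseteq> U"
    "\<And>x y. x \<in> ball q \<delta> \<Longrightarrow> y \<in> ball q \<delta> \<Longrightarrow> norm (f x - f y - D (x - y)) \<le> 1 * norm (x - y)"
    using lin[of 1] by auto
  have "dist (f x) (f y) \<le> (B + 1) * dist x y" if "x \<in> ball q \<delta>" "y \<in> ball q \<delta>" for x y
    using \<delta>(3)[OF that] B(2)[of "x - y"] norm_triangle_sub[of "f x - f y" "D (x - y)"]
    by (simp add: dist_norm algebra_simps)
  then show ?thesis using that[of "B + 1" \<delta>] B \<delta> by auto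
qed

text \<open>
A subspace of codimension one is the kernel of a unit vector \<open>b\<close>, so the hypersurface is
locally the zero set of the single function \<open>b \<bullet> \<phi> x\<close>, whose sign separates its two sides.
\<close>
lemma hypersurface_chart:
  fixes M :: "'a::euclidean_space set"
  assumes "C2_embedded_submanifold (DIM('a) - 1) M" "q \<in> M"
  obtains U V :: "'a set" and \<phi> \<psi> :: "'a \<Rightarrow> 'a" and b :: 'a where "open U" "open V" "q \<in> U" "homeomorphism U V \<phi> \<psi>"
    "C2_on U \<phi>" "C2_on V \<psi>" "norm b = 1" "\<forall>x\<in>U. x \<in> M \<longleftrightarrow> b \<bullet> \<phi> x = 0"
proof -
  obtain U V \<phi> \<psi> and S :: "'a set" where c: "open U" "open V" "q \<in> U" "homeomorphism U V \<phi> \<psi>"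
    "C2_on U \<phi>" "C2_on V \<psi>" and S: "subspace S" "dim S = DIM('a) - 1" "\<phi> ` (U \<inter> M) = V \<inter> S"
    using assms unfolding C2_embedded_submanifold_def by meson
  obtain a where a: "a \<noteq> 0" "span S = {x. a \<bullet> x = 0}"
    using lowdim_eq_hyperplane[OF S(2)] .
  define b where "b = a /\<^sub>R norm a"
  have nb: "norm b = 1" using a by (simp add: b_def)
  have Sb: "y \<in> S \<longleftrightarrow> b \<bullet> y = 0" for y
  proof -
    have "y \<in> S \<longleftrightarrow> y \<in> span S" by (simp only: span_eq_iff[THEN iffD2, OF S(1)])
    then show ?thesis using a by (simp add: b_def)
  qed
  have "x \<in> M \<longleftrightarrow> b \<bullet> \<phi> x = 0" if x: "x \<in> U" for x
  proof -
    have inj: "inj_on \<phi> U"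
      using c(4) by (metis homeomorphism_def inj_on_inverseI)
    have V: "\<phi> x \<in> V" using c(4) x by (metis homeomorphism_def imageI)
    have "x \<in> M \<longleftrightarrow> \<phi> x \<in> \<phi> ` (U \<inter> M)"
      using inj x by (auto simp: inj_on_def)
    then show ?thesis using S(3) V Sb by auto
  qed
  then show ?thesis using that[OF c nb] by blast
qed

text \<open>
Near \<open>q\<close> the boundary is the zero set of \<open>g x = b \<bullet> \<phi> x\<close>, and \<open>n\<close> is the normalized gradient of \<open>g\<close> at \<open>q\<close>.
A point that leaves the tangent hyperplane by more than a fraction \<open>e\<close> of its distance has \<open>g\<close> of
the corresponding sign by linearization. The two sides of the zero set are images of half balls, hence
connected and disjoint from the boundary, so each lies inside or outside of \<open>K\<close>. They cannot
both lie inside, since \<open>q\<close> would be interior; nor both outside, since \<open>K\<close> is the closure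
of an open set that avoids the boundary.
The same \<open>n\<close> serves all boundary points \<open>y\<close> near \<open>q\<close>, which later makes compactness arguments possible.
\<close>
lemma frontier_flat:
  fixes K :: "'a::euclidean_space set"
  assumes K0: "open K0" "K = closure K0" "frontier K0 = frontier K"
    and man: "C2_embedded_submanifold (DIM('a) - 1) (frontier K)" and q: "q \<in> frontier K"
  obtains n where "norm n = 1"
    "\<And>e. e > 0 \<Longrightarrow> \<exists>\<delta>>0. \<forall>y\<in>frontier K \<inter> ball q \<delta>. \<forall>x\<in>ball q \<delta>.
        (n \<bullet> (x - y) > e * norm (x - y) \<longrightarrow> x \<in> K) \<and> (n \<bullet> (x - y) < - (e * norm (x - y)) \<longrightarrow> x \<notin> K)"
proof -
  obtain U V :: "'a set" and \<phi> \<psi> :: "'a \<Rightarrow> 'a" and b0 :: 'a where c: "open U" "open V" "q \<in> U" and hom: "homeomorphism U V \<phi> \<psi>"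
    and C2: "C2_on U \<phi>" "C2_on V \<psi>" and b0: "norm b0 = 1"
    and M0: "\<And>x. x \<in> U \<Longrightarrow> x \<in> frontier K \<longleftrightarrow> b0 \<bullet> \<phi> x = 0"
    using hypersurface_chart[OF man q] by metis
  have closedK: "closed K" using K0 by simp
  have frK: "frontier K \<subseteq> K" using closedK frontier_subset_closed by blast
  have K0K: "K0 \<subseteq> K" using K0 closure_subset by blast
  have K0fr: "K0 \<inter> frontier K = {}"
    using K0 by (metis frontier_disjoint_eq inf_commute)
  have psi: "\<And>x. x \<in> U \<Longrightarrow> \<psi> (\<phi> x) = x" "\<And>y. y \<in> V \<Longrightarrow> \<phi> (\<psi> y) = y"
    "\<phi> ` U = V" "\<psi> ` V = U" "continuous_on U \<phi>" "continuous_on V \<psi>"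
    using hom by (auto simp: homeomorphism_def)
  have qV: "\<phi> q \<in> V" using c psi by auto
  obtain \<eta> where \<eta>: "\<eta> > 0" "ball (\<phi> q) \<eta> \<subseteq> V"
    using c qV open_contains_ball by blast
  define W where "W = \<psi> ` ball (\<phi> q) \<eta>"
  have WU: "W \<subseteq> U" using \<eta> psi unfolding W_def by blast
  have oW: "open W"
  proof -
    have "W = U \<inter> \<phi> -` ball (\<phi> q) \<eta>"
      using \<eta> psi unfolding W_def by force
    then show ?thesis using continuous_open_preimage[OF psi(5) c(1), of "ball (\<phi> q) \<eta>"] by simp
  qed
  have qW: "q \<in> W" unfolding W_def
    by (rule image_eqI[where x = "\<phi> q"]) (use c psi \<eta> in auto)
  have side: "{x\<in>W. v \<bullet> \<phi> x > 0} \<subseteq> K \<or> {x\<in>W. v \<bullet> \<phi> x > 0} \<inter> K = {}"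
    if v: "v = b0 \<or> v = -b0" for v
  proof -
    have eq: "{x\<in>W. v \<bullet> \<phi> x > 0} = \<psi> ` (ball (\<phi> q) \<eta> \<inter> {y. v \<bullet> y > 0})"
      using \<eta> psi unfolding W_def by force
    have "connected (ball (\<phi> q) \<eta> \<inter> {y. v \<bullet> y > 0})"
      by (intro convex_connected convex_Int convex_ball convex_halfspace_gt)
    then have con: "connected {x\<in>W. v \<bullet> \<phi> x > 0}"
      unfolding eq using psi(6) \<eta>(2) by (metis connected_continuous_image continuous_on_subset inf.coboundedI1)
    have "{x\<in>W. v \<bullet> \<phi> x > 0} \<inter> frontier K = {}"
      using M0 WU v by auto
    with connected_Int_frontier[OF con, of K] show ?thesis by blast
  qed
  have notboth: "\<not> ({x\<in>W. b0 \<bullet> \<phi> x > 0} \<subseteq> K \<and> {x\<in>W. -b0 \<bullet> \<phi> x > 0} \<subseteq> K)"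
  proof
    assume a: "{x\<in>W. b0 \<bullet> \<phi> x > 0} \<subseteq> K \<and> {x\<in>W. -b0 \<bullet> \<phi> x > 0} \<subseteq> K"
    have "W \<subseteq> K"
    proof
      fix x assume x: "x \<in> W"
      consider "b0 \<bullet> \<phi> x > 0" | "-b0 \<bullet> \<phi> x > 0" | "b0 \<bullet> \<phi> x = 0" by force
      then show "x \<in> K" using a x M0 frK WU by cases auto
    qed
    then have "q \<in> interior K" using oW qW interior_maximal by blast
    then show False using q by (auto simp: frontier_def)
  qed
  have notnone: "\<not> ({x\<in>W. b0 \<bullet> \<phi> x > 0} \<inter> K = {} \<and> {x\<in>W. -b0 \<bullet> \<phi> x > 0} \<inter> K = {})"
  proof
    assume a: "{x\<in>W. b0 \<bullet> \<phi> x > 0} \<inter> K = {} \<and> {x\<in>W. -b0 \<bullet> \<phi> x > 0} \<inter> K = {}"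
    have "q \<in> closure K0" using q frK K0 by blast
    then obtain x where x: "x \<in> W" "x \<in> K0"
      using oW qW by (metis closure_iff_nhds_not_empty disjoint_iff subset_refl)
    then have "b0 \<bullet> \<phi> x \<noteq> 0" using M0 WU K0fr by blast
    then have "b0 \<bullet> \<phi> x > 0 \<or> -b0 \<bullet> \<phi> x > 0" by auto
    then show False using a x K0K by auto
  qed
  obtain b where b: "b = b0 \<or> b = -b0" and pos: "\<And>x. x \<in> W \<Longrightarrow> b \<bullet> \<phi> x > 0 \<Longrightarrow> x \<in> K"
    and neg: "\<And>x. x \<in> W \<Longrightarrow> b \<bullet> \<phi> x < 0 \<Longrightarrow> x \<notin> K"
  proof -
    have *: "({x\<in>W. b0 \<bullet> \<phi> x > 0} \<subseteq> K \<and> {x\<in>W. -b0 \<bullet> \<phi> x > 0} \<inter> K = {}) \<or>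
        ({x\<in>W. -b0 \<bullet> \<phi> x > 0} \<subseteq> K \<and> {x\<in>W. b0 \<bullet> \<phi> x > 0} \<inter> K = {})"
      using side[of b0] side[of "-b0"] notboth notnone by blast
    then show ?thesis
    proof
      assume "{x\<in>W. b0 \<bullet> \<phi> x > 0} \<subseteq> K \<and> {x\<in>W. -b0 \<bullet> \<phi> x > 0} \<inter> K = {}"
      then show ?thesis using that[of b0] by auto
    next
      assume "{x\<in>W. -b0 \<bullet> \<phi> x > 0} \<subseteq> K \<and> {x\<in>W. b0 \<bullet> \<phi> x > 0} \<inter> K = {}"
      then show ?thesis using that[of "-b0"] by auto
    qed
  qed
  have nb: "norm b = 1" using b b0 by auto
  have M: "b \<bullet> \<phi> x = 0" if "x \<in> W" "x \<in> frontier K" for x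
    using M0[of x] that WU b by auto
  obtain D where D: "(\<phi> has_derivative D) (at q)"
    and lin: "\<And>e. e > 0 \<Longrightarrow> \<exists>\<delta>>0. ball q \<delta> \<subseteq> U \<and>
           (\<forall>x\<in>ball q \<delta>. \<forall>y\<in>ball q \<delta>. norm (\<phi> x - \<phi> y - D (x - y)) \<le> e * norm (x - y))"
    using C2_on_linearization[OF C2(1) c(1,3)] by blast
  obtain E where E: "(\<psi> has_derivative E) (at (\<phi> q))"
    by (rule C2_on_linearization[OF C2(2) c(2) qV]) (rule that)
  have linD: "linear D" using D has_derivative_linear by blast
  \<comment> \<open>The derivative of a diffeomorphism is onto, so the gradient of the local equation does not vanish.\<close>
  have DE: "D (E y) = y" for y
  proof -
    have "(\<phi> has_derivative D) (at (\<psi> (\<phi> q)))" using D c psi by simp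
    then have "((\<lambda>y. \<phi> (\<psi> y)) has_derivative (\<lambda>y. D (E y))) (at (\<phi> q))"
      by (rule has_derivative_compose[OF E])
    then have "((\<lambda>y. y) has_derivative (\<lambda>y. D (E y))) (at (\<phi> q))"
      by (rule has_derivative_transform_within_open[OF _ c(2) qV]) (simp add: psi)
    then have "(\<lambda>y. D (E y)) = (\<lambda>y. y)"
      using has_derivative_unique has_derivative_ident by blast
    then show ?thesis by meson
  qed
  define a where "a = adjoint D b"
  have a: "a \<bullet> x = b \<bullet> D x" for x
    using adjoint_works[OF linD, of x b] by (simp add: a_def inner_commute)
  have "a \<noteq> 0"
  proof
    assume "a = 0"
    then have "b \<bullet> b = 0" using a[of "E b"] DE by simp
    then show False using nb by auto
  qed
  define n where "n = a /\<^sub>R norm a"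
  have nn: "norm n = 1" using \<open>a \<noteq> 0\<close> by (simp add: n_def)
  have nD: "b \<bullet> D x = norm a * (n \<bullet> x)" for x
    using a[of x] \<open>a \<noteq> 0\<close> by (simp add: n_def)
  have "\<exists>\<delta>>0. \<forall>y\<in>frontier K \<inter> ball q \<delta>. \<forall>x\<in>ball q \<delta>.
        (n \<bullet> (x - y) > e * norm (x - y) \<longrightarrow> x \<in> K) \<and> (n \<bullet> (x - y) < - (e * norm (x - y)) \<longrightarrow> x \<notin> K)"
    if e: "e > 0" for e
  proof -
    obtain r where r: "r > 0" "ball q r \<subseteq> W" using oW qW open_contains_ball by blast
    have "e * norm a > 0" using e \<open>a \<noteq> 0\<close> by simp
    from lin[OF this] obtain \<delta> where \<delta>: "\<delta> > 0"
      "\<And>x y. x \<in> ball q \<delta> \<Longrightarrow> y \<in> ball q \<delta> \<Longrightarrow> norm (\<phi> x - \<phi> y - D (x - y)) \<le> e * norm a * norm (x - y)"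
      by blast
    have "(n \<bullet> (x - y) > e * norm (x - y) \<longrightarrow> x \<in> K) \<and> (n \<bullet> (x - y) < - (e * norm (x - y)) \<longrightarrow> x \<notin> K)"
      if y: "y \<in> frontier K \<inter> ball q (min \<delta> r)" and x: "x \<in> ball q (min \<delta> r)" for x y
    proof -
      have xW: "x \<in> W" "y \<in> W" using x y r by auto
      have "\<bar>b \<bullet> (\<phi> x - \<phi> y - D (x - y))\<bar> \<le> norm b * norm (\<phi> x - \<phi> y - D (x - y))"
        by (rule Cauchy_Schwarz_ineq2)
      also have "\<dots> \<le> norm a * (e * norm (x - y))"
        using \<delta>(2)[of x y] x y nb by (simp add: mult_ac)
      finally have *: "\<bar>b \<bullet> \<phi> x - norm a * (n \<bullet> (x - y))\<bar> \<le> norm a * (e * norm (x - y))"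
        using M[of y] y xW by (simp add: inner_diff_right nD)
      have na: "norm a > 0" using \<open>a \<noteq> 0\<close> by simp
      show ?thesis
      proof (intro conjI impI)
        assume "n \<bullet> (x - y) > e * norm (x - y)"
        then have "norm a * (n \<bullet> (x - y)) > norm a * (e * norm (x - y))" using na by simp
        then have "b \<bullet> \<phi> x > 0" using * by linarith
        then show "x \<in> K" using pos xW by blast
      next
        assume "n \<bullet> (x - y) < - (e * norm (x - y))"
        then have "norm a * (n \<bullet> (x - y)) < norm a * - (e * norm (x - y))"
          using na mult_less_cancel_left_pos by blast
        then have "b \<bullet> \<phi> x < 0" using * by (simp add: abs_le_iff)
        then show "x \<notin> K" using neg xW by blast
      qed
    qed
    then show ?thesis using \<delta>(1) r(1) by (intro exI[of _ "min \<delta> r"]) auto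
  qed
  with nn that show ?thesis by blast
qed

section \<open>Volume of small balls in the body\<close>

text \<open>
By reflection an open half ball has half of the volume of the ball, and caps cut off
slightly above the equator exhaust it.
\<close>
lemma half_ball_volume:
  fixes n :: "'a::euclidean_space"
  assumes "n \<noteq> 0" "\<theta> < 1"
  obtains s where "s > 0"
    "\<theta> * unit_ball_vol (real DIM('a)) / 2 \<le> measure lborel {u \<in> ball 0 1. n \<bullet> u > s}"
proof -
  let ?v = "unit_ball_vol (real DIM('a))"
  let ?H = "\<lambda>n s. {u \<in> ball (0::'a) 1. n \<bullet> u > s}"
  have meas: "?H n s \<in> sets borel" for n s
    by (intro borel_open) (auto intro!: open_Collect_conj open_Collect_less continuous_intros)
  have fin: "?H n s \<in> fmeasurable lborel" for n s
  proof -
    have "emeasure lborel (?H n s) \<le> emeasure lborel (ball (0::'a) 1)"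
      by (rule emeasure_mono) auto
    also have "\<dots> < \<infinity>" by (rule emeasure_lborel_ball_finite)
    finally show ?thesis using meas by (simp add: fmeasurable_def)
  qed
  have refl: "measure lborel (?H n 0) = measure lborel (?H (-n) 0)"
  proof -
    have "(\<lambda>u. -1 *\<^sub>R u + 0) ` (?H n 0) = ?H (-n) 0"
    proof -
      have "u \<in> (\<lambda>u. -1 *\<^sub>R u + 0) ` (?H n 0)" if "u \<in> ?H (-n) 0" for u
        by (rule image_eqI[where x = "-u"]) (use that in auto)
      then show ?thesis by auto
    qed
    then have "measure lebesgue (?H (-n) 0) = measure lebesgue (?H n 0)"
      using measure_lebesgue_affine[of "-1" 0 "?H n 0"] by simp
    then show ?thesis using meas by (simp add: measure_completion)
  qed
  have null: "{u. n \<bullet> u = 0} \<in> null_sets lborel"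
    using negligible_hyperplane[of n 0] assms(1)
    by (simp add: negligible_iff_null_sets null_sets_completion_iff closed_hyperplane)
  have half: "measure lborel (?H n 0) = ?v / 2"
  proof -
    have "ball (0::'a) 1 = (?H n 0 \<union> ?H (-n) 0) \<union> (ball 0 1 \<inter> {u. n \<bullet> u = 0})" by auto
    moreover have "ball 0 1 \<inter> {u. n \<bullet> u = 0} \<in> null_sets lborel"
      using null by (rule null_set_Int1) simp
    ultimately have "measure lborel (ball (0::'a) 1) = measure lborel (?H n 0 \<union> ?H (-n) 0)"
      using measure_Un_null_set[of "?H n 0 \<union> ?H (-n) 0" lborel "ball 0 1 \<inter> {u. n \<bullet> u = 0}"]
        meas[where n = n and s = 0] meas[where n = "-n" and s = 0] by (simp only: sets.Un sets_lborel)
    also have "\<dots> = measure lborel (?H n 0) + measure lborel (?H (-n) 0)"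
    proof -
      have "?H (-n) 0 - ?H n 0 = ?H (-n) 0" by auto
      then show ?thesis using measure_Un2[OF fin[where n = n and s = 0] fin[where n = "-n" and s = 0]] by simp
    qed
    finally show ?thesis using refl content_ball[of 1 "0::'a"] by simp
  qed
  have lim: "(\<lambda>k. measure lborel (?H n (1 / real (Suc k)))) \<longlonglongrightarrow> measure lborel (\<Union>k. ?H n (1 / real (Suc k)))"
  proof (rule Lim_measure_incseq)
    show "range (\<lambda>k. ?H n (1 / real (Suc k))) \<subseteq> sets lborel" using meas by auto
    show "incseq (\<lambda>k. ?H n (1 / real (Suc k)))"
    proof (rule incseq_SucI)
      fix k have "1 / real (Suc (Suc k)) \<le> 1 / real (Suc k)" by (simp add: frac_le)
      then show "?H n (1 / real (Suc k)) \<subseteq> ?H n (1 / real (Suc (Suc k)))" by auto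
    qed
    have "(\<Union>k. ?H n (1 / real (Suc k))) \<subseteq> ball 0 1" by auto
    then have "emeasure lborel (\<Union>k. ?H n (1 / real (Suc k))) \<le> emeasure lborel (ball (0::'a) 1)"
      by (rule emeasure_mono) simp
    then show "emeasure lborel (\<Union>k. ?H n (1 / real (Suc k))) \<noteq> \<infinity>"
      using emeasure_lborel_ball_finite[of "0::'a" 1] by auto
  qed
  have un: "(\<Union>k. ?H n (1 / real (Suc k))) = ?H n 0"
  proof -
    have "\<exists>k. 1 / real (Suc k) < n \<bullet> u" if "0 < n \<bullet> u" for u
      using reals_Archimedean[OF that] by (simp add: inverse_eq_divide)
    moreover have "0 < n \<bullet> u" if "1 / real (Suc k) < n \<bullet> u" for u k
      using that by (meson less_trans of_nat_0_less_iff zero_less_Suc zero_less_divide_1_iff)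
    ultimately show ?thesis by auto
  qed
  have "\<theta> * ?v / 2 < ?v / 2" using assms(2) by (simp add: unit_ball_vol_pos)
  then have "\<forall>\<^sub>F k in sequentially. \<theta> * ?v / 2 < measure lborel (?H n (1 / real (Suc k)))"
    by (rule order_tendstoD(1)[OF lim[unfolded un half]])
  then obtain k where "\<theta> * ?v / 2 < measure lborel (?H n (1 / real (Suc k)))"
    using eventually_sequentially by auto
  then show ?thesis using that[of "1 / real (Suc k)"] by simp
qed

text \<open>
Caps around \<open>x\<close> of radius \<open>r\<close> are images of caps of the unit ball under a homothety.
\<close>
lemma measure_cap_scale:
  fixes x n :: "'a::euclidean_space"
  assumes "r > 0"
  shows "measure lborel {y \<in> ball x r. n \<bullet> (y - x) > s * r}
    = r ^ DIM('a) * measure lborel {u \<in> ball 0 1. n \<bullet> u > s}"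
proof -
  let ?A = "{u \<in> ball 0 1. n \<bullet> u > s}" and ?B = "{y \<in> ball x r. n \<bullet> (y - x) > s * r}"
  have m: "?A \<in> sets borel" "?B \<in> sets borel"
    by (intro borel_open; auto intro!: open_Collect_conj open_Collect_less continuous_intros)+
  have "(\<lambda>u. r *\<^sub>R u + x) ` ?A = ?B"
  proof (intro equalityI subsetI)
    fix y assume "y \<in> (\<lambda>u. r *\<^sub>R u + x) ` ?A"
    then obtain u where u: "norm u < 1" "n \<bullet> u > s" "y = r *\<^sub>R u + x" by auto
    have "dist x y = r * norm u" using assms u by (simp add: dist_norm)
    then show "y \<in> ?B" using u assms by (simp add: mult.commute)
  next
    fix y assume y: "y \<in> ?B"
    have "norm (y - x) / r < 1" using y assms by (simp add: dist_norm norm_minus_commute)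
    moreover have "n \<bullet> (y - x) / r > s" using y assms by (simp add: pos_less_divide_eq)
    ultimately show "y \<in> (\<lambda>u. r *\<^sub>R u + x) ` ?A"
      using assms by (intro image_eqI[where x = "(y - x) /\<^sub>R r"]) (auto simp: divide_inverse mult.commute)
  qed
  then have "measure lebesgue ?B = r ^ DIM('a) * measure lebesgue ?A"
    using measure_lebesgue_affine[of r x ?A] assms by simp
  then show ?thesis using m by (simp add: measure_completion)
qed

lemma compact_uniform_radius:
  fixes S :: "'a::metric_space set"
  assumes "compact S"
    and loc: "\<And>q. q \<in> S \<Longrightarrow> \<exists>\<delta>>0. \<forall>y\<in>S \<inter> ball q \<delta>. \<forall>r. 0 < r \<and> r < \<delta> \<longrightarrow> Q y r"
  obtains r0 :: real where "r0 > 0" "\<And>y r. y \<in> S \<Longrightarrow> 0 < r \<Longrightarrow> r < r0 \<Longrightarrow> Q y r"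
proof -
  obtain \<delta> where \<delta>: "\<And>q. q \<in> S \<Longrightarrow> \<delta> q > 0 \<and> (\<forall>y\<in>S \<inter> ball q (\<delta> q). \<forall>r. 0 < r \<and> r < \<delta> q \<longrightarrow> Q y r)"
    using loc by metis
  have "S \<subseteq> (\<Union>q\<in>S. ball q (\<delta> q))" using \<delta> by force
  then obtain F where F: "F \<subseteq> S" "finite F" "S \<subseteq> (\<Union>q\<in>F. ball q (\<delta> q))"
    using compactE_image[OF assms(1), of S "\<lambda>q. ball q (\<delta> q)"] by auto
  define r0 where "r0 = Min (insert 1 (\<delta> ` F))"
  have "r0 > 0" using F \<delta> by (auto simp: r0_def)
  moreover have "Q y r" if yr: "y \<in> S" "0 < r" "r < r0" for y r
  proof -
    obtain q where q: "q \<in> F" "y \<in> ball q (\<delta> q)" using F(3) yr(1) by blast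
    then have "r < \<delta> q" using yr F by (auto simp: r0_def)
    then show ?thesis using \<delta>[of q] q F yr by auto
  qed
  ultimately show ?thesis using that by blast
qed

locale smooth_body =
  fixes K :: "'a::euclidean_space set"
  assumes compact: "compact K"
    and pos: "0 < emeasure lborel K"
    and regular: "\<exists>K0. open K0 \<and> K = closure K0 \<and> frontier K0 = frontier K"
    and smooth: "C2_embedded_submanifold (DIM('a) - 1) (frontier K)"
begin

lemma K_meas: "K \<in> fmeasurable lborel"
  using compact by (simp add: fmeasurable_compact)

lemma frontier_sub: "frontier K \<subseteq> K"
  using compact compact_imp_closed frontier_subset_closed by blast

lemma compact_frontier: "compact (frontier K)"
  using compact by (simp add: compact_frontier)

lemma frontier_ne: "frontier K \<noteq> {}"
proof -
  have "K \<noteq> {}" using pos by auto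
  moreover have "K \<noteq> UNIV" using compact compact_imp_bounded not_bounded_UNIV by auto
  ultimately show ?thesis using frontier_eq_empty by blast
qed

lemma flat:
  assumes "q \<in> frontier K"
  obtains n where "norm n = 1"
    "\<And>e. e > 0 \<Longrightarrow> \<exists>\<delta>>0. \<forall>y\<in>frontier K \<inter> ball q \<delta>. \<forall>x\<in>ball q \<delta>.
        (n \<bullet> (x - y) > e * norm (x - y) \<longrightarrow> x \<in> K) \<and> (n \<bullet> (x - y) < - (e * norm (x - y)) \<longrightarrow> x \<notin> K)"
proof -
  obtain K0 where K0: "open K0" "K = closure K0" "frontier K0 = frontier K" using regular by blast
  show ?thesis by (rule frontier_flat[OF K0 smooth assms]) (rule that)
qed

lemma meas_K_Int_ball: "K \<inter> ball x r \<in> fmeasurable lborel"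
  using K_meas by (intro fmeasurable_Int_fmeasurable) auto

text \<open>
Flatness forces \<open>K\<close> to avoid a cap of the ball that has almost half of its volume.
\<close>
lemma volume_at_frontier_upper:
  assumes q: "q \<in> frontier K" and \<theta>: "\<theta> > 1"
  shows "\<exists>\<delta>>0. \<forall>y\<in>frontier K \<inter> ball q \<delta>. \<forall>r. 0 < r \<and> r < \<delta> \<longrightarrow>
           measure lborel (K \<inter> ball y r) \<le> \<theta> * unit_ball_vol (real DIM('a)) / 2 * r ^ DIM('a)"
proof -
  obtain n where n: "norm n = 1" and fl: "\<And>e. e > 0 \<Longrightarrow> \<exists>\<delta>>0. \<forall>y\<in>frontier K \<inter> ball q \<delta>. \<forall>x\<in>ball q \<delta>.
        (n \<bullet> (x - y) > e * norm (x - y) \<longrightarrow> x \<in> K) \<and> (n \<bullet> (x - y) < - (e * norm (x - y)) \<longrightarrow> x \<notin> K)"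
    by (rule flat[OF q]) (rule that)
  have "-n \<noteq> 0" "2 - \<theta> < 1" using n \<theta> by auto
  from half_ball_volume[OF this] obtain s where s: "s > 0"
    "(2 - \<theta>) * unit_ball_vol (real DIM('a)) / 2 \<le> measure lborel {u \<in> ball 0 1. -n \<bullet> u > s}" by blast
  obtain \<delta> where \<delta>: "\<delta> > 0" "\<And>y x. y \<in> frontier K \<inter> ball q \<delta> \<Longrightarrow> x \<in> ball q \<delta> \<Longrightarrow>
       n \<bullet> (x - y) < - (s * norm (x - y)) \<Longrightarrow> x \<notin> K"
    using fl[OF s(1)] by blast
  have "measure lborel (K \<inter> ball y r) \<le> \<theta> * unit_ball_vol (real DIM('a)) / 2 * r ^ DIM('a)"
    if y: "y \<in> frontier K \<inter> ball q (\<delta> / 2)" and r: "0 < r" "r < \<delta> / 2" for y r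
  proof -
    let ?C = "{x \<in> ball y r. -n \<bullet> (x - y) > s * r}"
    have C: "?C \<in> sets lborel"
      unfolding sets_lborel
      by (intro borel_open) (auto intro!: open_Collect_conj open_Collect_less continuous_intros)
    have "K \<inter> ball y r \<subseteq> ball y r - ?C"
    proof -
      have "x \<notin> K" if x: "x \<in> ?C" for x
      proof (rule \<delta>(2)[of y])
        have "dist q x < \<delta>" using x y r dist_triangle[of q x y] by (auto simp: dist_commute)
        then show "x \<in> ball q \<delta>" by simp
        show "y \<in> frontier K \<inter> ball q \<delta>" using y \<delta>(1) by auto
        have "norm (x - y) \<le> r" using x by (auto simp: dist_norm norm_minus_commute)
        then have "s * norm (x - y) \<le> s * r" using s by simp
        then show "n \<bullet> (x - y) < - (s * norm (x - y))" using x by auto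
      qed
      then show ?thesis by blast
    qed
    then have "measure lborel (K \<inter> ball y r) \<le> measure lborel (ball y r - ?C)"
      by (rule measure_mono_fmeasurable[OF _ fmeasurableD[OF meas_K_Int_ball]
            fmeasurable_Diff[OF _ C]])
        (use emeasure_lborel_ball_finite[of y r] in \<open>auto simp: fmeasurable_def\<close>)
    also have "\<dots> = measure lborel (ball y r) - measure lborel ?C"
      by (rule measure_Diff) (use C emeasure_lborel_ball_finite[of y r] in auto)
    also have "\<dots> \<le> unit_ball_vol (real DIM('a)) * r ^ DIM('a) - r ^ DIM('a) * ((2 - \<theta>) * unit_ball_vol (real DIM('a)) / 2)"
      using s(2) r measure_cap_scale[of r y s "-n"]
      by (simp add: content_ball mult_left_mono)
    also have "\<dots> = \<theta> * unit_ball_vol (real DIM('a)) / 2 * r ^ DIM('a)" by (simp add: field_simps)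
    finally show ?thesis .
  qed
  then show ?thesis using \<delta>(1) by (intro exI[of _ "\<delta> / 2"]) auto
qed

lemma volume_interior:
  assumes "x \<in> K" "ball x r \<inter> frontier K = {}" "r > 0"
  shows "measure lborel (K \<inter> ball x r) = unit_ball_vol (real DIM('a)) * r ^ DIM('a)"
proof -
  have "x \<in> ball x r \<inter> K" using assms by auto
  then have "ball x r \<subseteq> K" using connected_Int_frontier[OF connected_ball, of x r K] assms by blast
  then have "K \<inter> ball x r = ball x r" by blast
  then show ?thesis using assms by (simp add: content_ball)
qed

text \<open>
Every small ball with centre in \<open>K\<close> has at least about half of its volume in \<open>K\<close>, no matter where
the centre lies. If the ball meets the boundary at \<open>y\<close>, flatness at \<open>y\<close> shows first that the
centre \<open>x\<close> is not far on the wrong side of the tangent hyperplane, and then that \<open>K\<close> contains the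
cap of the ball on the right side of the parallel hyperplane slightly beyond \<open>x\<close>.
\<close>
lemma volume_lower:
  assumes \<theta>: "\<theta> < 1"
  obtains r0 where "r0 > 0"
    "\<And>x r. x \<in> K \<Longrightarrow> 0 < r \<Longrightarrow> r < r0 \<Longrightarrow> \<theta> * unit_ball_vol (real DIM('a)) / 2 * r ^ DIM('a) \<le> measure lborel (K \<inter> ball x r)"
proof -
  define Q where "Q = (\<lambda>y r. \<forall>x\<in>K. dist x y < r \<longrightarrow> \<theta> * unit_ball_vol (real DIM('a)) / 2 * r ^ DIM('a) \<le> measure lborel (K \<inter> ball x r))"
  have "\<exists>\<delta>>0. \<forall>y\<in>frontier K \<inter> ball q \<delta>. \<forall>r. 0 < r \<and> r < \<delta> \<longrightarrow> Q y r" if q: "q \<in> frontier K" for q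
  proof -
    obtain n where n: "norm n = 1" and fl: "\<And>e. e > 0 \<Longrightarrow> \<exists>\<delta>>0. \<forall>y\<in>frontier K \<inter> ball q \<delta>. \<forall>x\<in>ball q \<delta>.
        (n \<bullet> (x - y) > e * norm (x - y) \<longrightarrow> x \<in> K) \<and> (n \<bullet> (x - y) < - (e * norm (x - y)) \<longrightarrow> x \<notin> K)"
      by (rule flat[OF q]) (rule that)
    have "n \<noteq> 0" using n by auto
    then obtain s where s: "s > 0"
      "\<theta> * unit_ball_vol (real DIM('a)) / 2 \<le> measure lborel {u \<in> ball 0 1. n \<bullet> u > s}"
      using \<theta> by (rule half_ball_volume)
    \<comment> \<open>Of the four units of \<open>e * r\<close> in \<open>s * r\<close>, two are lost since \<open>z\<close> may be at distance \<open>2 * r\<close> from \<open>y\<close>, and a third one for the position of \<open>x\<close>.\<close>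
    define e where "e = s / 4"
    have e: "e > 0" using s by (simp add: e_def)
    obtain \<delta> where \<delta>: "\<delta> > 0" "\<And>y x. y \<in> frontier K \<inter> ball q \<delta> \<Longrightarrow> x \<in> ball q \<delta> \<Longrightarrow>
       (n \<bullet> (x - y) > e * norm (x - y) \<longrightarrow> x \<in> K) \<and> (n \<bullet> (x - y) < - (e * norm (x - y)) \<longrightarrow> x \<notin> K)"
      using fl[OF e] by meson
    have "\<theta> * unit_ball_vol (real DIM('a)) / 2 * r ^ DIM('a) \<le> measure lborel (K \<inter> ball x r)"
      if y: "y \<in> frontier K \<inter> ball q (\<delta> / 3)" and r: "0 < r" "r < \<delta> / 3" and x: "x \<in> K" "dist x y < r" for x y r
    proof -
      let ?C = "{z \<in> ball x r. n \<bullet> (z - x) > s * r}"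
      have C: "?C \<in> sets lborel"
        unfolding sets_lborel
        by (intro borel_open) (auto intro!: open_Collect_conj open_Collect_less continuous_intros)
      have y': "y \<in> frontier K \<inter> ball q \<delta>" using y \<delta>(1) by auto
      have "x \<in> ball q \<delta>"
        using y x r dist_triangle[of q x y] by (auto simp: dist_commute)
      then have "n \<bullet> (x - y) \<ge> - (e * norm (x - y))" using \<delta>(2)[OF y'] x by fastforce
      moreover have "e * norm (x - y) \<le> e * r" using x e by (simp add: dist_norm)
      ultimately have nx: "n \<bullet> (x - y) \<ge> - (e * r)" by linarith
      have "z \<in> K" if z: "z \<in> ?C" for z
      proof -
        have zy: "dist z y \<le> 2 * r"
          using z x dist_triangle[of z y x] by (auto simp: dist_commute)
        then have zq: "z \<in> ball q \<delta>"
          using y r dist_triangle[of q z y] by (auto simp: dist_commute)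
        have "n \<bullet> (z - y) = n \<bullet> (z - x) + n \<bullet> (x - y)" by (simp add: inner_diff_right)
        then have "n \<bullet> (z - y) > s * r - e * r" using z nx by auto
        moreover have "e * norm (z - y) \<le> e * (2 * r)" using zy e by (simp add: dist_norm)
        moreover have "s * r - e * r - e * (2 * r) > 0" using e r s by (simp add: e_def)
        ultimately have "n \<bullet> (z - y) > e * norm (z - y)" by linarith
        then show ?thesis using \<delta>(2)[OF y' zq] by blast
      qed
      then have sub: "?C \<subseteq> K \<inter> ball x r" by blast
      have "\<theta> * unit_ball_vol (real DIM('a)) / 2 * r ^ DIM('a) \<le> r ^ DIM('a) * measure lborel {u \<in> ball 0 1. n \<bullet> u > s}"
        using s(2) r by (simp add: mult.commute mult_left_mono)
      also have "\<dots> = measure lborel ?C" using measure_cap_scale[of r x s n] r by simp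
      also have "\<dots> \<le> measure lborel (K \<inter> ball x r)"
        by (rule measure_mono_fmeasurable[OF sub C meas_K_Int_ball])
      finally show ?thesis .
    qed
    then show ?thesis unfolding Q_def using \<delta>(1) by (intro exI[of _ "\<delta> / 3"]) auto
  qed
  then obtain r0 where r0: "r0 > 0" "\<And>y r. y \<in> frontier K \<Longrightarrow> 0 < r \<Longrightarrow> r < r0 \<Longrightarrow> Q y r"
    using compact_uniform_radius[OF compact_frontier, of Q] by blast
  have "\<theta> * unit_ball_vol (real DIM('a)) / 2 * r ^ DIM('a) \<le> measure lborel (K \<inter> ball x r)" if x: "x \<in> K" and r: "0 < r" "r < r0" for x r
  proof (cases "ball x r \<inter> frontier K = {}")
    case True
    have "\<theta> * unit_ball_vol (real DIM('a)) / 2 * r ^ DIM('a) \<le> unit_ball_vol (real DIM('a)) * r ^ DIM('a)"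
      using \<theta> r unit_ball_vol_pos[of "real d"] by (intro mult_right_mono) (auto simp: field_simps)
    then show ?thesis using volume_interior[OF x True r(1)] by simp
  next
    case False
    then obtain y where "y \<in> frontier K" "dist x y < r" by auto
    then show ?thesis using r0(2)[of y r] r x by (auto simp: Q_def)
  qed
  then show ?thesis using r0(1) that by blast
qed

end

section \<open>Covering and packing of hypersurfaces\<close>

text \<open>
Upper bound \<open>k\<close> on the Minkowski dimension, in the strong form that the covering numbers are of
order \<open>1 / \<delta> ^ k\<close>. Centres are required to lie in the set, so that the property can be moved along
Lipschitz maps that are controlled on the set only.
\<close>
definition covering_order :: "nat \<Rightarrow> 'a::metric_space set \<Rightarrow> bool" where
  "covering_order k A \<longleftrightarrow> (\<exists>C>0. \<forall>\<delta>. 0 < \<delta> \<and> \<delta> \<le> 1 \<longrightarrow>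
     (\<exists>F. finite F \<and> F \<subseteq> A \<and> real (card F) \<le> C / \<delta> ^ k \<and> A \<subseteq> (\<Union>x\<in>F. cball x \<delta>)))"

lemma recenter_cover:
  fixes A :: "'a::metric_space set"
  assumes "finite F" "A \<subseteq> (\<Union>x\<in>F. cball x (\<delta> / 2))"
  obtains G where "finite G" "G \<subseteq> A" "card G \<le> card F" "A \<subseteq> (\<Union>x\<in>G. cball x \<delta>)"
proof -
  define F' where "F' = {x\<in>F. cball x (\<delta> / 2) \<inter> A \<noteq> {}}"
  have "\<forall>x\<in>F'. \<exists>a. a \<in> cball x (\<delta> / 2) \<inter> A" unfolding F'_def by blast
  then obtain g where g: "\<And>x. x \<in> F' \<Longrightarrow> g x \<in> cball x (\<delta> / 2) \<inter> A" by metis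
  have F': "finite F'" "F' \<subseteq> F" using assms by (auto simp: F'_def)
  have cov: "A \<subseteq> (\<Union>x\<in>g ` F'. cball x \<delta>)"
  proof
    fix a assume a: "a \<in> A"
    then obtain x where x: "x \<in> F" "a \<in> cball x (\<delta> / 2)" using assms by blast
    then have xF: "x \<in> F'" using a by (auto simp: F'_def)
    have "dist (g x) a \<le> \<delta>"
      using g[OF xF] x dist_triangle[of "g x" a x] by (simp add: dist_commute)
    then show "a \<in> (\<Union>x\<in>g ` F'. cball x \<delta>)" using xF by auto
  qed
  have card: "card (g ` F') \<le> card F"
    using F' assms by (meson card_image_le card_mono order_trans)
  have sub: "g ` F' \<subseteq> A" using g by blast
  show ?thesis by (rule that[OF finite_imageI[OF F'(1)] sub card cov])
qed

lemma covering_orderE: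
  assumes "covering_order k A"
  obtains C where "C > 0" "\<And>\<delta>. 0 < \<delta> \<Longrightarrow> \<delta> \<le> 1 \<Longrightarrow>
     \<exists>F. finite F \<and> F \<subseteq> A \<and> real (card F) \<le> C / \<delta> ^ k \<and> A \<subseteq> (\<Union>x\<in>F. cball x \<delta>)"
proof -
  obtain C where C: "C > 0" "\<forall>\<delta>. 0 < \<delta> \<and> \<delta> \<le> 1 \<longrightarrow>
     (\<exists>F. finite F \<and> F \<subseteq> A \<and> real (card F) \<le> C / \<delta> ^ k \<and> A \<subseteq> (\<Union>x\<in>F. cball x \<delta>))"
    using assms unfolding covering_order_def by (elim exE conjE)
  show ?thesis by (rule that[OF C(1)]) (use C(2) in simp)
qed

lemma covering_orderI:
  fixes A :: "'a::metric_space set"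
  assumes "C > 0" "\<And>\<delta>. 0 < \<delta> \<Longrightarrow> \<delta> \<le> 1 \<Longrightarrow>
     \<exists>F. finite F \<and> real (card F) \<le> C / \<delta> ^ k \<and> A \<subseteq> (\<Union>x\<in>F. cball x \<delta>)"
  shows "covering_order k A"
  unfolding covering_order_def
proof (intro exI[of _ "C * 2 ^ k"] conjI allI impI)
  show "C * 2 ^ k > 0" using assms by simp
  fix \<delta> :: real assume \<delta>: "0 < \<delta> \<and> \<delta> \<le> 1"
  then have "0 < \<delta> / 2" "\<delta> / 2 \<le> 1" by auto
  from assms(2)[OF this] obtain F
    where F: "finite F" "real (card F) \<le> C / (\<delta> / 2) ^ k" "A \<subseteq> (\<Union>x\<in>F. cball x (\<delta> / 2))"
    by (elim exE conjE)
  obtain G where G: "finite G" "G \<subseteq> A" "card G \<le> card F" "A \<subseteq> (\<Union>x\<in>G. cball x \<delta>)"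
    using recenter_cover[OF F(1,3)] .
  have "real (card G) \<le> C * 2 ^ k / \<delta> ^ k"
    using F(2) G(3) by (simp add: power_divide)
  then show "\<exists>F. finite F \<and> F \<subseteq> A \<and> real (card F) \<le> C * 2 ^ k / \<delta> ^ k \<and> A \<subseteq> (\<Union>x\<in>F. cball x \<delta>)"
    using G(1,2,4) by (intro exI conjI)
qed

lemma covering_order_subset:
  assumes "covering_order k A" "B \<subseteq> A"
  shows "covering_order k B"
proof -
  obtain C where C: "C > 0" "\<And>\<delta>. 0 < \<delta> \<Longrightarrow> \<delta> \<le> 1 \<Longrightarrow>
     \<exists>F. finite F \<and> F \<subseteq> A \<and> real (card F) \<le> C / \<delta> ^ k \<and> A \<subseteq> (\<Union>x\<in>F. cball x \<delta>)"
    by (rule covering_orderE[OF assms(1)]) (rule that)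
  show ?thesis
  proof (rule covering_orderI[OF C(1)])
    fix \<delta> :: real assume "0 < \<delta>" "\<delta> \<le> 1"
    from C(2)[OF this] assms(2)
    show "\<exists>F. finite F \<and> real (card F) \<le> C / \<delta> ^ k \<and> B \<subseteq> (\<Union>x\<in>F. cball x \<delta>)"
      by (elim exE conjE) (intro exI conjI, assumption, assumption, rule order_trans)
  qed
qed

lemma covering_order_lipschitz:
  assumes "covering_order k A" and L: "\<And>x y. x \<in> A \<Longrightarrow> y \<in> A \<Longrightarrow> dist (f x) (f y) \<le> L * dist x y"
  shows "covering_order k (f ` A)"
proof -
  obtain C where C: "C > 0" "\<And>\<delta>. 0 < \<delta> \<Longrightarrow> \<delta> \<le> 1 \<Longrightarrow>
     \<exists>F. finite F \<and> F \<subseteq> A \<and> real (card F) \<le> C / \<delta> ^ k \<and> A \<subseteq> (\<Union>x\<in>F. cball x \<delta>)"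
    by (rule covering_orderE[OF assms(1)]) (rule that)
  define M where "M = max L 1"
  have M: "M \<ge> 1" "L \<le> M" by (auto simp: M_def)
  show ?thesis
  proof (rule covering_orderI)
    show "C * M ^ k > 0" using C M by simp
    fix \<delta> :: real assume \<delta>: "0 < \<delta>" "\<delta> \<le> 1"
    have "0 < \<delta> / M" "\<delta> / M \<le> 1" using \<delta> M by (auto simp: field_simps)
    from C(2)[OF this] obtain F where F: "finite F" "F \<subseteq> A" "real (card F) \<le> C / (\<delta> / M) ^ k"
        "A \<subseteq> (\<Union>x\<in>F. cball x (\<delta> / M))"
      by (elim exE conjE)
    have "f ` A \<subseteq> (\<Union>x\<in>f ` F. cball x \<delta>)"
    proof
      fix y assume "y \<in> f ` A"
      then obtain a where a: "a \<in> A" "y = f a" by blast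
      then obtain x where x: "x \<in> F" "dist x a \<le> \<delta> / M" using F(4) by auto
      have "dist (f x) (f a) \<le> L * dist x a" using L x a F by blast
      also have "\<dots> \<le> M * dist x a" using M by (intro mult_right_mono) auto
      also have "\<dots> \<le> M * (\<delta> / M)" using M x by (intro mult_left_mono) auto
      finally have "dist (f x) (f a) \<le> \<delta>" using M by simp
      then show "y \<in> (\<Union>x\<in>f ` F. cball x \<delta>)" using x a by auto
    qed
    moreover have "real (card (f ` F)) \<le> C * M ^ k / \<delta> ^ k"
      using F(3) card_image_le[OF F(1), of f] by (simp add: power_divide)
    ultimately show "\<exists>F. finite F \<and> real (card F) \<le> C * M ^ k / \<delta> ^ k \<and> f ` A \<subseteq> (\<Union>x\<in>F. cball x \<delta>)"
      using F(1) by (intro exI[of _ "f ` F"]) auto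
  qed
qed

lemma covering_order_Un:
  assumes "covering_order k A" "covering_order k B"
  shows "covering_order k (A \<union> B)"
proof -
  obtain C where C: "C > 0" "\<And>\<delta>. 0 < \<delta> \<Longrightarrow> \<delta> \<le> 1 \<Longrightarrow>
     \<exists>F. finite F \<and> F \<subseteq> A \<and> real (card F) \<le> C / \<delta> ^ k \<and> A \<subseteq> (\<Union>x\<in>F. cball x \<delta>)"
    by (rule covering_orderE[OF assms(1)]) (rule that)
  obtain D where D: "D > 0" "\<And>\<delta>. 0 < \<delta> \<Longrightarrow> \<delta> \<le> 1 \<Longrightarrow>
     \<exists>F. finite F \<and> F \<subseteq> B \<and> real (card F) \<le> D / \<delta> ^ k \<and> B \<subseteq> (\<Union>x\<in>F. cball x \<delta>)"
    by (rule covering_orderE[OF assms(2)]) (rule that)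
  show ?thesis
  proof (rule covering_orderI)
    show "C + D > 0" using C D by simp
    fix \<delta> :: real assume \<delta>: "0 < \<delta>" "\<delta> \<le> 1"
    obtain F where F: "finite F" "real (card F) \<le> C / \<delta> ^ k" "A \<subseteq> (\<Union>x\<in>F. cball x \<delta>)"
      using C(2)[OF \<delta>] by (elim exE conjE)
    obtain G where G: "finite G" "real (card G) \<le> D / \<delta> ^ k" "B \<subseteq> (\<Union>x\<in>G. cball x \<delta>)"
      using D(2)[OF \<delta>] by (elim exE conjE)
    have "real (card (F \<union> G)) \<le> (C + D) / \<delta> ^ k"
      using card_Un_le[of F G] F(2) G(2) by (simp add: add_divide_distrib)
    then show "\<exists>F. finite F \<and> real (card F) \<le> (C + D) / \<delta> ^ k \<and> A \<union> B \<subseteq> (\<Union>x\<in>F. cball x \<delta>)"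
      using F G by (intro exI[of _ "F \<union> G"]) auto
  qed
qed

lemma covering_order_compact:
  fixes A :: "'a::metric_space set"
  assumes "compact A" "\<And>q. q \<in> A \<Longrightarrow> \<exists>\<delta>>0. covering_order k (A \<inter> ball q \<delta>)"
  shows "covering_order k A"
proof -
  obtain \<delta> where \<delta>: "\<And>q. q \<in> A \<Longrightarrow> \<delta> q > 0 \<and> covering_order k (A \<inter> ball q (\<delta> q))"
    using assms(2) by metis
  have "A \<subseteq> (\<Union>q\<in>A. ball q (\<delta> q))" using \<delta> by force
  then obtain F where F: "F \<subseteq> A" "finite F" "A \<subseteq> (\<Union>q\<in>F. ball q (\<delta> q))"
    using compactE_image[OF assms(1), of A "\<lambda>q. ball q (\<delta> q)"] by auto
  \<comment> \<open>Constants of finitely many local covers add up.\<close>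
  have "covering_order k (\<Union>q\<in>F. A \<inter> ball q (\<delta> q))"
    using F(2,1)
  proof (induction F)
    case empty
    have "covering_order k ({} :: 'a set)"
      by (rule covering_orderI[of 1]) (auto intro!: exI[of _ "{}"])
    then show ?case by simp
  next
    case (insert q F)
    then show ?case using covering_order_Un[of k "A \<inter> ball q (\<delta> q)"] \<delta> by auto
  qed
  then show ?thesis by (rule covering_order_subset) (use F in auto)
qed

lemma inner_orthonormal_sum:
  fixes B :: "'a::real_inner set"
  assumes "finite B" "pairwise orthogonal B" "\<And>b. b \<in> B \<Longrightarrow> norm b = 1" "c \<in> B"
  shows "c \<bullet> (\<Sum>b\<in>B. f b *\<^sub>R b) = f c"
proof -
  have "c \<bullet> (\<Sum>b\<in>B. f b *\<^sub>R b) = (\<Sum>b\<in>B. if b = c then f c else 0)"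
    unfolding inner_sum_right
  proof (rule sum.cong)
    fix b assume b: "b \<in> B"
    show "c \<bullet> (f b *\<^sub>R b) = (if b = c then f c else 0)"
    proof (cases "b = c")
      case True
      then show ?thesis using assms(3)[OF b] by (simp add: dot_square_norm)
    next
      case False
      then have "c \<bullet> b = 0" using assms(2,4) b by (auto simp: pairwise_def orthogonal_def)
      then show ?thesis using False by simp
    qed
  qed simp
  then show ?thesis using assms by simp
qed

text \<open>
Round the coordinates with respect to an orthonormal basis to multiples of a small mesh.
\<close>
lemma subspace_ball_covering_order:
  fixes S :: "'a::euclidean_space set"
  assumes S: "subspace S"
  shows "covering_order (dim S) (S \<inter> ball p R)"
proof -
  obtain B where B: "B \<subseteq> S" "pairwise orthogonal B" "\<And>b. b \<in> B \<Longrightarrow> norm b = 1"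
    "independent B" "card B = dim S" "span B = S"
    using orthonormal_basis_subspace[OF S] by metis
  have fB: "finite B" using B(4) independent_imp_finite by blast
  define N where "N = real DIM('a)"
  have N: "N > 0" "real (card B) \<le> N" using B(5) dim_subset_UNIV[of S] by (auto simp: N_def)
  define R' where "R' = norm p + \<bar>R\<bar>"
  have R': "R' \<ge> 0" by (simp add: R'_def)
  show ?thesis
  proof (rule covering_orderI)
    show "(2 * R' * N + 3) ^ dim S > 0" using R' N by (intro zero_less_power add_nonneg_pos) auto
    fix \<delta> :: real assume \<delta>: "0 < \<delta>" "\<delta> \<le> 1"
    define t where "t = \<delta> / N"
    have t: "t > 0" using \<delta> N by (simp add: t_def)
    define m where "m = \<lceil>R' / t\<rceil>"
    have "R' / t \<ge> 0" using R' t by simp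
    then have m: "m \<ge> 0" unfolding m_def by linarith
    define g where "g = (\<lambda>k :: 'a \<Rightarrow> int. \<Sum>b\<in>B. (real_of_int (k b) * t) *\<^sub>R b)"
    define F where "F = g ` (PiE B (\<lambda>_. {-m..m}))"
    have finF: "finite F" unfolding F_def using fB by (intro finite_imageI finite_PiE) auto
    have "card F \<le> card (PiE B (\<lambda>_. {-m..m}))"
      unfolding F_def using fB by (intro card_image_le finite_PiE) auto
    also have "\<dots> = nat (2 * m + 1) ^ dim S" using fB B(5) by (simp add: card_PiE)
    finally have "real (card F) \<le> real (nat (2 * m + 1)) ^ dim S" by (metis of_nat_le_iff of_nat_power)
    also have "\<dots> \<le> ((2 * R' * N + 3) / \<delta>) ^ dim S"
    proof (rule power_mono)
      have "real (nat (2 * m + 1)) = 2 * real_of_int m + 1" using m by simp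
      also have "\<dots> \<le> 2 * (R' / t + 1) + 1" using of_int_ceiling_le_add_one[of "R' / t"]
        unfolding m_def by (intro add_mono mult_left_mono) auto
      also have "\<dots> = 2 * R' * N / \<delta> + 3" by (simp add: t_def)
      also have "\<dots> \<le> 2 * R' * N / \<delta> + 3 / \<delta>" using \<delta> by (simp add: field_simps)
      finally show "real (nat (2 * m + 1)) \<le> (2 * R' * N + 3) / \<delta>" by (simp add: add_divide_distrib)
    qed simp
    finally have card: "real (card F) \<le> (2 * R' * N + 3) ^ dim S / \<delta> ^ dim S" by (simp add: power_divide)
    have "S \<inter> ball p R \<subseteq> (\<Union>x\<in>F. cball x \<delta>)"
    proof
      fix x assume x: "x \<in> S \<inter> ball p R"
      have nx: "norm x \<le> R'"
        using x norm_triangle_ineq2[of x p] by (auto simp: R'_def dist_norm norm_minus_commute)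
      define k where "k = (\<lambda>b\<in>B. \<lfloor>(b \<bullet> x) / t\<rfloor>)"
      have "k \<in> PiE B (\<lambda>_. {-m..m})"
      proof (rule PiE_I)
        fix b assume b: "b \<in> B"
        have "\<bar>b \<bullet> x\<bar> \<le> R'" using Cauchy_Schwarz_ineq2[of b x] B(3)[OF b] nx by simp
        then have "(b \<bullet> x) / t \<le> R' / t" "- (R' / t) \<le> (b \<bullet> x) / t"
          using t by (auto simp: field_simps abs_le_iff)
        then show "k b \<in> {-m..m}" unfolding k_def m_def using b by (simp) linarith
      qed (simp add: k_def)
      then have gF: "g k \<in> F" by (simp add: F_def)
      have "x = (\<Sum>b\<in>B. (b \<bullet> x) *\<^sub>R b)"
        using orthonormal_basis_expand[OF B(2,3) _ fB, of x] x B(6) by (simp add: inner_commute)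
      then have "x - g k = (\<Sum>b\<in>B. (b \<bullet> x - real_of_int (k b) * t) *\<^sub>R b)"
        by (simp add: g_def sum_subtractf scaleR_diff_left)
      then have "norm (x - g k) \<le> (\<Sum>b\<in>B. norm ((b \<bullet> x - real_of_int (k b) * t) *\<^sub>R b))"
        by (simp only: norm_sum)
      also have "\<dots> \<le> (\<Sum>b\<in>B. t)"
      proof (rule sum_mono)
        fix b assume b: "b \<in> B"
        define w where "w = (b \<bullet> x) / t"
        have w: "b \<bullet> x = w * t" using t by (simp add: w_def)
        have "\<bar>w - real_of_int \<lfloor>w\<rfloor>\<bar> \<le> 1" by linarith
        then have "\<bar>w - real_of_int \<lfloor>w\<rfloor>\<bar> * t \<le> 1 * t" using t by (intro mult_right_mono) auto
        moreover have "b \<bullet> x - real_of_int (k b) * t = (w - real_of_int \<lfloor>w\<rfloor>) * t"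
          using b t by (simp add: k_def w_def left_diff_distrib)
        ultimately show "norm ((b \<bullet> x - real_of_int (k b) * t) *\<^sub>R b) \<le> t"
          using t B(3)[OF b] by (simp add: abs_mult)
      qed
      also have "\<dots> \<le> N * t" using N t by (simp add: mult_right_mono)
      also have "\<dots> = \<delta>" using N by (simp add: t_def)
      finally show "x \<in> (\<Union>x\<in>F. cball x \<delta>)" using gF by (auto simp: dist_norm norm_minus_commute)
    qed
    then show "\<exists>F. finite F \<and> real (card F) \<le> (2 * R' * N + 3) ^ dim S / \<delta> ^ dim S \<and>
        S \<inter> ball p R \<subseteq> (\<Union>x\<in>F. cball x \<delta>)"
      using finF card by (intro exI conjI)
  qed
qed

text \<open>
The points of an orthonormal grid of mesh \<open>\<delta>\<close> have mutual distance at least \<open>\<delta>\<close>.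
\<close>
lemma subspace_ball_packing:
  fixes S :: "'a::euclidean_space set"
  assumes S: "subspace S" and p: "p \<in> S" and \<eta>: "\<eta> > 0"
  obtains c where "c > 0" "\<And>\<delta>. \<delta> > 0 \<Longrightarrow> \<exists>F. finite F \<and> F \<subseteq> S \<inter> ball p \<eta> \<and> c / \<delta> ^ dim S \<le> real (card F) \<and>
      (\<forall>x\<in>F. \<forall>y\<in>F. x \<noteq> y \<longrightarrow> \<delta> \<le> dist x y)"
proof -
  obtain B where B: "B \<subseteq> S" "pairwise orthogonal B" "\<And>b. b \<in> B \<Longrightarrow> norm b = 1"
    "independent B" "card B = dim S" "span B = S"
    using orthonormal_basis_subspace[OF S] by metis
  have fB: "finite B" using B(4) independent_imp_finite by blast
  define N where "N = real DIM('a)"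
  have N: "N > 0" "real (card B) \<le> N" using B(5) dim_subset_UNIV[of S] by (auto simp: N_def)
  have "\<exists>F. finite F \<and> F \<subseteq> S \<inter> ball p \<eta> \<and> (\<eta> / N) ^ dim S / \<delta> ^ dim S \<le> real (card F) \<and>
      (\<forall>x\<in>F. \<forall>y\<in>F. x \<noteq> y \<longrightarrow> \<delta> \<le> dist x y)" if \<delta>: "\<delta> > 0" for \<delta>
  proof -
    define m where "m = \<lceil>\<eta> / (N * \<delta>)\<rceil>"
    have m1: "m > 0" using \<eta> N \<delta> by (simp add: m_def)
    have m2: "real_of_int m - 1 < \<eta> / (N * \<delta>)" unfolding m_def by linarith
    define g where "g = (\<lambda>k :: 'a \<Rightarrow> int. p + (\<Sum>b\<in>B. (real_of_int (k b) * \<delta>) *\<^sub>R b))"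
    let ?P = "PiE B (\<lambda>_. {0..<m})"
    have sep: "\<delta> \<le> dist (g k) (g l)" if kl: "k \<in> ?P" "l \<in> ?P" "k \<noteq> l" for k l
    proof -
      obtain c where c: "c \<in> B" "k c \<noteq> l c" using kl by (metis PiE_ext)
      have "g k - g l = (\<Sum>b\<in>B. ((real_of_int (k b) - real_of_int (l b)) * \<delta>) *\<^sub>R b)"
        by (simp add: g_def sum_subtractf scaleR_diff_left left_diff_distrib)
      then have "c \<bullet> (g k - g l) = (real_of_int (k c) - real_of_int (l c)) * \<delta>"
        using inner_orthonormal_sum[OF fB B(2,3) c(1)] by simp
      moreover have "\<bar>real_of_int (k c) - real_of_int (l c)\<bar> \<ge> 1" using c(2) by linarith
      ultimately have "\<delta> \<le> \<bar>c \<bullet> (g k - g l)\<bar>" using \<delta> by (simp add: abs_mult)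
      also have "\<dots> \<le> norm (g k - g l)"
        using Cauchy_Schwarz_ineq2[of c "g k - g l"] B(3)[OF c(1)] by simp
      finally show ?thesis by (simp add: dist_norm)
    qed
    have inj: "inj_on g ?P"
    proof (rule inj_onI, rule ccontr)
      fix k l assume "k \<in> ?P" "l \<in> ?P" "g k = g l" "k \<noteq> l"
      then show False using sep[of k l] \<delta> by simp
    qed
    have "card (g ` ?P) = nat m ^ dim S" using card_image[OF inj] fB B(5) by (simp add: card_PiE)
    moreover have "(\<eta> / (N * \<delta>)) ^ dim S \<le> real (nat m) ^ dim S"
      using m1 \<eta> N \<delta> by (intro power_mono) (auto simp: m_def)
    ultimately have card: "(\<eta> / N) ^ dim S / \<delta> ^ dim S \<le> real (card (g ` ?P))"
      by (simp add: power_divide power_mult_distrib)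
    have "g k \<in> S \<inter> ball p \<eta>" if k: "k \<in> ?P" for k
    proof
      show "g k \<in> S" unfolding g_def
        using S p B(1) by (intro subspace_add subspace_sum subspace_scale) auto
      have "norm (g k - p) \<le> (\<Sum>b\<in>B. norm ((real_of_int (k b) * \<delta>) *\<^sub>R b))"
        unfolding g_def add_diff_cancel_left' by (rule norm_sum)
      also have "\<dots> \<le> (\<Sum>b\<in>B. (real_of_int m - 1) * \<delta>)"
      proof (rule sum_mono)
        fix b assume b: "b \<in> B"
        then have "0 \<le> k b" "k b \<le> m - 1" using k by (auto simp: PiE_iff)
        then show "norm ((real_of_int (k b) * \<delta>) *\<^sub>R b) \<le> (real_of_int m - 1) * \<delta>"
          using B(3)[OF b] \<delta> by (simp add: abs_mult)
      qed
      also have "\<dots> \<le> N * ((real_of_int m - 1) * \<delta>)" using N m1 \<delta> by (simp add: mult_right_mono)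
      also have "\<dots> < \<eta>" using m2 N \<delta> by (simp add: field_simps)
      finally show "g k \<in> ball p \<eta>" by (simp add: dist_norm norm_minus_commute)
    qed
    moreover have "finite (g ` ?P)" using fB by (intro finite_imageI finite_PiE) auto
    moreover have "\<forall>x\<in>g ` ?P. \<forall>y\<in>g ` ?P. x \<noteq> y \<longrightarrow> \<delta> \<le> dist x y" using sep by blast
    ultimately show ?thesis using card by (intro exI[of _ "g ` ?P"]) auto
  qed
  moreover have "(\<eta> / N) ^ dim S > 0" using \<eta> N by simp
  ultimately show ?thesis by (rule that[rotated])
qed

text \<open>
A chart and its inverse are both differentiable with continuous derivative, so both are
Lipschitz on small balls. The chart is presented by its inverse \<open>\<psi>\<close> on a ball, which parametrizes
a neighbourhood of \<open>q\<close>; the hypersurface corresponds to the hyperplane orthogonal to \<open>b\<close>.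
\<close>
lemma hypersurface_bilipschitz_chart:
  fixes M :: "'a::euclidean_space set"
  assumes "C2_embedded_submanifold (DIM('a) - 1) M" "q \<in> M" "\<rho> > 0"
  obtains \<psi> :: "'a \<Rightarrow> 'a" and b p :: 'a and \<eta> L :: real
  where "b \<noteq> 0" "b \<bullet> p = 0" "\<eta> > 0" "L > 0" "open (\<psi> ` ball p \<eta>)" "q \<in> \<psi> ` ball p \<eta>"
    "\<psi> ` ball p \<eta> \<subseteq> ball q \<rho>" "\<And>y. y \<in> ball p \<eta> \<Longrightarrow> \<psi> y \<in> M \<longleftrightarrow> b \<bullet> y = 0"
    "\<And>y z. y \<in> ball p \<eta> \<Longrightarrow> z \<in> ball p \<eta> \<Longrightarrow> dist (\<psi> y) (\<psi> z) \<le> L * dist y z"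
    "\<And>y z. y \<in> ball p \<eta> \<Longrightarrow> z \<in> ball p \<eta> \<Longrightarrow> dist y z \<le> L * dist (\<psi> y) (\<psi> z)"
proof -
  obtain U V :: "'a set" and \<phi> \<psi> :: "'a \<Rightarrow> 'a" and b :: 'a where c: "open U" "open V" "q \<in> U" and hom: "homeomorphism U V \<phi> \<psi>"
    and C2: "C2_on U \<phi>" "C2_on V \<psi>" and b: "norm b = 1"
    and M0: "\<forall>x\<in>U. x \<in> M \<longleftrightarrow> b \<bullet> \<phi> x = 0"
    using hypersurface_chart[OF assms(1,2)] by metis
  have psi: "\<And>x. x \<in> U \<Longrightarrow> \<psi> (\<phi> x) = x" "\<And>y. y \<in> V \<Longrightarrow> \<phi> (\<psi> y) = y"
    "\<phi> ` U = V" "\<psi> ` V = U" "continuous_on U \<phi>" "continuous_on V \<psi>"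
    using hom by (auto simp: homeomorphism_def)
  define p where "p = \<phi> q"
  have pV: "p \<in> V" using c psi by (auto simp: p_def)
  have pq: "\<psi> p = q" using psi c by (simp add: p_def)
  obtain L1 \<delta>1 where L1: "L1 > 0" "\<delta>1 > 0" "ball q \<delta>1 \<subseteq> U"
    "\<And>x y. x \<in> ball q \<delta>1 \<Longrightarrow> y \<in> ball q \<delta>1 \<Longrightarrow> dist (\<phi> x) (\<phi> y) \<le> L1 * dist x y"
    using C2_on_lipschitz[OF C2(1) c(1,3)] by metis
  obtain L2 \<delta>2 where L2: "L2 > 0" "\<delta>2 > 0" "ball p \<delta>2 \<subseteq> V"
    "\<And>x y. x \<in> ball p \<delta>2 \<Longrightarrow> y \<in> ball p \<delta>2 \<Longrightarrow> dist (\<psi> x) (\<psi> y) \<le> L2 * dist x y"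
    using C2_on_lipschitz[OF C2(2) c(2) pV] by metis
  define \<rho>' where "\<rho>' = min \<delta>1 \<rho>"
  have \<rho>': "\<rho>' > 0" "\<rho>' \<le> \<delta>1" "\<rho>' \<le> \<rho>" using L1 assms by (auto simp: \<rho>'_def)
  define \<eta> where "\<eta> = min \<delta>2 (\<rho>' / L2)"
  have \<eta>: "\<eta> > 0" "\<eta> \<le> \<delta>2" "L2 * \<eta> \<le> \<rho>'" using \<rho>' L2 by (auto simp: \<eta>_def min_def field_simps)
  have img: "\<psi> y \<in> ball q \<rho>'" if y: "y \<in> ball p \<eta>" for y
  proof -
    have "dist q (\<psi> y) \<le> L2 * dist p y" using L2(4)[of p y] y \<eta> L2 pq by auto
    also have "\<dots> < L2 * \<eta>" using y L2 by simp
    finally show ?thesis using \<eta> by simp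
  qed
  have Vb: "y \<in> V" if "y \<in> ball p \<eta>" for y using that \<eta> L2(3) by auto
  have opn: "open (\<psi> ` ball p \<eta>)"
  proof -
    have "\<psi> ` ball p \<eta> = U \<inter> \<phi> -` ball p \<eta>"
    proof (intro equalityI subsetI)
      fix x assume "x \<in> \<psi> ` ball p \<eta>"
      then obtain y where "y \<in> ball p \<eta>" "x = \<psi> y" by blast
      then show "x \<in> U \<inter> \<phi> -` ball p \<eta>" using Vb[of y] psi(2,4) by auto
    next
      fix x assume "x \<in> U \<inter> \<phi> -` ball p \<eta>"
      then show "x \<in> \<psi> ` ball p \<eta>" using psi(1)[of x] by (intro image_eqI[where x = "\<phi> x"]) auto
    qed
    then show ?thesis using continuous_open_preimage[OF psi(5) c(1), of "ball p \<eta>"] by simp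
  qed
  define L where "L = max L1 L2"
  show ?thesis
  proof (rule that[of b p \<eta> L \<psi>])
    show "b \<noteq> 0" using b by auto
    show "b \<bullet> p = 0" using M0 assms c by (auto simp: p_def)
    show "\<eta> > 0" "L > 0" using \<eta> L1 by (auto simp: L_def)
    show "open (\<psi> ` ball p \<eta>)" by fact
    show "q \<in> \<psi> ` ball p \<eta>" by (rule image_eqI[where x = p]) (use pq \<eta> in auto)
    show "\<psi> ` ball p \<eta> \<subseteq> ball q \<rho>" using img \<rho>' by fastforce
    fix y assume y: "y \<in> ball p \<eta>"
    show "\<psi> y \<in> M \<longleftrightarrow> b \<bullet> y = 0" using M0 Vb[OF y] psi by auto
    fix z assume z: "z \<in> ball p \<eta>"
    have "dist (\<psi> y) (\<psi> z) \<le> L2 * dist y z" using L2(4)[of y z] y z \<eta> by auto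
    also have "\<dots> \<le> L * dist y z" by (intro mult_right_mono) (auto simp: L_def)
    finally show "dist (\<psi> y) (\<psi> z) \<le> L * dist y z" .
    have "dist y z \<le> L1 * dist (\<psi> y) (\<psi> z)"
      using L1(4)[of "\<psi> y" "\<psi> z"] img[OF y] img[OF z] \<rho>' psi Vb[OF y] Vb[OF z] by auto
    also have "\<dots> \<le> L * dist (\<psi> y) (\<psi> z)" by (intro mult_right_mono) (auto simp: L_def)
    finally show "dist y z \<le> L * dist (\<psi> y) (\<psi> z)" .
  qed
qed

lemma hypersurface_covering_order:
  fixes M :: "'a::euclidean_space set"
  assumes "C2_embedded_submanifold (DIM('a) - 1) M" "compact M"
  shows "covering_order (DIM('a) - 1) M"
proof (rule covering_order_compact[OF assms(2)])
  fix q assume q: "q \<in> M"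
  obtain \<psi> :: "'a \<Rightarrow> 'a" and b p \<eta> L where ch: "b \<noteq> 0" "open (\<psi> ` ball p \<eta>)" "q \<in> \<psi> ` ball p \<eta>"
    "\<And>y. y \<in> ball p \<eta> \<Longrightarrow> \<psi> y \<in> M \<longleftrightarrow> b \<bullet> y = 0"
    "\<And>y z. y \<in> ball p \<eta> \<Longrightarrow> z \<in> ball p \<eta> \<Longrightarrow> dist (\<psi> y) (\<psi> z) \<le> L * dist y z"
    by (rule hypersurface_bilipschitz_chart[OF assms(1) q zero_less_one]) (rule that)
  let ?S = "{y. b \<bullet> y = 0}"
  have "covering_order (DIM('a) - 1) (?S \<inter> ball p \<eta>)"
    using subspace_ball_covering_order[OF subspace_hyperplane[of b], of p \<eta>] dim_hyperplane[OF ch(1)] by simp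
  then have cov: "covering_order (DIM('a) - 1) (\<psi> ` (?S \<inter> ball p \<eta>))"
    by (rule covering_order_lipschitz) (use ch(5) in auto)
  obtain \<delta> where "\<delta> > 0" "ball q \<delta> \<subseteq> \<psi> ` ball p \<eta>" using ch(2,3) open_contains_ball by blast
  then have "M \<inter> ball q \<delta> \<subseteq> \<psi> ` (?S \<inter> ball p \<eta>)" using ch(4) by auto
  then show "\<exists>\<delta>>0. covering_order (DIM('a) - 1) (M \<inter> ball q \<delta>)"
    using covering_order_subset[OF cov] \<open>\<delta> > 0\<close> by blast
qed

lemma hypersurface_packing:
  fixes M :: "'a::euclidean_space set"
  assumes "C2_embedded_submanifold (DIM('a) - 1) M" "q \<in> M" "\<rho> > 0"
  obtains c where "c > 0" "\<And>\<delta>. \<delta> > 0 \<Longrightarrow> \<exists>F. finite F \<and> F \<subseteq> M \<inter> ball q \<rho> \<and> c / \<delta> ^ (DIM('a) - 1) \<le> real (card F) \<and>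
      (\<forall>x\<in>F. \<forall>y\<in>F. x \<noteq> y \<longrightarrow> \<delta> \<le> dist x y)"
proof -
  obtain \<psi> :: "'a \<Rightarrow> 'a" and b p \<eta> L where ch: "b \<noteq> 0" "b \<bullet> p = 0" "\<eta> > 0" "L > 0"
    "\<psi> ` ball p \<eta> \<subseteq> ball q \<rho>"
    "\<And>y. y \<in> ball p \<eta> \<Longrightarrow> \<psi> y \<in> M \<longleftrightarrow> b \<bullet> y = 0"
    "\<And>y z. y \<in> ball p \<eta> \<Longrightarrow> z \<in> ball p \<eta> \<Longrightarrow> dist y z \<le> L * dist (\<psi> y) (\<psi> z)"
    by (rule hypersurface_bilipschitz_chart[OF assms]) (rule that)
  let ?S = "{y. b \<bullet> y = 0}"
  have "p \<in> ?S" using ch by simp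
  then obtain c where c: "c > 0" "\<And>\<delta>. \<delta> > 0 \<Longrightarrow> \<exists>F. finite F \<and> F \<subseteq> ?S \<inter> ball p \<eta> \<and> c / \<delta> ^ (DIM('a) - 1) \<le> real (card F) \<and>
      (\<forall>x\<in>F. \<forall>y\<in>F. x \<noteq> y \<longrightarrow> \<delta> \<le> dist x y)"
    using subspace_ball_packing[OF subspace_hyperplane[of b] _ ch(3)] dim_hyperplane[OF ch(1)] by metis
  have "\<exists>F. finite F \<and> F \<subseteq> M \<inter> ball q \<rho> \<and> (c / L ^ (DIM('a) - 1)) / \<delta> ^ (DIM('a) - 1) \<le> real (card F) \<and>
      (\<forall>x\<in>F. \<forall>y\<in>F. x \<noteq> y \<longrightarrow> \<delta> \<le> dist x y)" if \<delta>: "\<delta> > 0" for \<delta>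
  proof -
    have "L * \<delta> > 0" using \<delta> ch by simp
    from c(2)[OF this] obtain F where F: "finite F" "F \<subseteq> ?S \<inter> ball p \<eta>"
      "c / (L * \<delta>) ^ (DIM('a) - 1) \<le> real (card F)"
      "\<forall>x\<in>F. \<forall>y\<in>F. x \<noteq> y \<longrightarrow> L * \<delta> \<le> dist x y"
      by (elim exE conjE)
    have sep: "\<delta> \<le> dist (\<psi> x) (\<psi> y)" if xy: "x \<in> F" "y \<in> F" "x \<noteq> y" for x y
    proof -
      have "L * \<delta> \<le> L * dist (\<psi> x) (\<psi> y)" using F(2,4) ch(7)[of x y] xy by fastforce
      then show ?thesis using ch(4) by simp
    qed
    then have "inj_on \<psi> F" using \<delta> by (intro inj_onI) fastforce
    then have "card (\<psi> ` F) = card F" by (rule card_image)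
    then have "(c / L ^ (DIM('a) - 1)) / \<delta> ^ (DIM('a) - 1) \<le> real (card (\<psi> ` F))"
      using F(3) by (simp add: power_mult_distrib)
    moreover have "\<psi> ` F \<subseteq> M \<inter> ball q \<rho>" using F(2) ch(5,6) by blast
    moreover have "\<forall>x\<in>\<psi> ` F. \<forall>y\<in>\<psi> ` F. x \<noteq> y \<longrightarrow> \<delta> \<le> dist x y" using sep by blast
    ultimately show ?thesis using F(1) by (intro exI[of _ "\<psi> ` F"]) auto
  qed
  moreover have "c / L ^ (DIM('a) - 1) > 0" using c ch by simp
  ultimately show ?thesis by (rule that[rotated])
qed

section \<open>Balls that contain none of the random points\<close>

text \<open>
Second moment method. If \<open>Z\<close> counts the events that occur, then negative correlation bounds its
variance by its mean \<open>s\<close>, and \<open>(1 - Z / s)\<^sup>2\<close> dominates the indicator of \<open>Z = 0\<close>.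
\<close>
lemma (in prob_space) prob_none_le_inverse_sum:
  fixes E :: "'i \<Rightarrow> 'a set"
  assumes F: "finite F" "\<And>f. f \<in> F \<Longrightarrow> E f \<in> events"
    and neg: "\<And>f g. f \<in> F \<Longrightarrow> g \<in> F \<Longrightarrow> f \<noteq> g \<Longrightarrow> prob (E f \<inter> E g) \<le> prob (E f) * prob (E g)"
    and s: "s = (\<Sum>f\<in>F. prob (E f))" "s > 0"
  shows "prob (space M - (\<Union>f\<in>F. E f)) \<le> 1 / s"
proof -
  define Z where "Z = (\<lambda>\<omega>. \<Sum>f\<in>F. indicat_real (E f) \<omega>)"
  have Z2: "(Z \<omega>)\<^sup>2 = (\<Sum>f\<in>F. \<Sum>g\<in>F. indicat_real (E f \<inter> E g) \<omega>)" for \<omega>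
    by (simp add: Z_def power2_eq_square sum_product indicator_inter_arith)
  have iE: "integrable M (indicat_real (E f))" if "f \<in> F" for f
    using F(2)[OF that] by (simp add: integrable_indicator_iff less_top[symmetric])
  have iEE: "integrable M (indicat_real (E f \<inter> E g))" if "f \<in> F" "g \<in> F" for f g
    using F(2)[OF that(1)] F(2)[OF that(2)] by (simp add: integrable_indicator_iff less_top[symmetric] sets.Int)
  have iZ: "integrable M Z" unfolding Z_def using iE by (intro Bochner_Integration.integrable_sum)
  have iZ2: "integrable M (\<lambda>\<omega>. (Z \<omega>)\<^sup>2)" unfolding Z2 using iEE by (intro Bochner_Integration.integrable_sum)
  have EZ: "expectation Z = s"
    unfolding Z_def using F iE s(1) by (simp add: Bochner_Integration.integral_sum)
  have row: "(\<Sum>g\<in>F. prob (E f \<inter> E g)) \<le> prob (E f) + prob (E f) * s" if f: "f \<in> F" for f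
  proof -
    have "(\<Sum>g\<in>F. prob (E f \<inter> E g)) = prob (E f) + (\<Sum>g\<in>F - {f}. prob (E f \<inter> E g))"
      using F(1) f by (simp add: sum.remove)
    also have "(\<Sum>g\<in>F - {f}. prob (E f \<inter> E g)) \<le> (\<Sum>g\<in>F - {f}. prob (E f) * prob (E g))"
      using neg f by (intro sum_mono) auto
    also have "\<dots> \<le> (\<Sum>g\<in>F. prob (E f) * prob (E g))"
      using F(1) by (intro sum_mono2) auto
    finally show ?thesis by (simp add: s(1) sum_distrib_left)
  qed
  have "expectation (\<lambda>\<omega>. (Z \<omega>)\<^sup>2) = (\<Sum>f\<in>F. \<Sum>g\<in>F. prob (E f \<inter> E g))"
    unfolding Z2 using F iEE by (simp add: Bochner_Integration.integral_sum sets.Int)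
  also have "\<dots> \<le> (\<Sum>f\<in>F. prob (E f) + prob (E f) * s)"
    using row by (intro sum_mono)
  also have "\<dots> = s + s\<^sup>2" by (simp add: sum.distrib s(1) sum_distrib_right power2_eq_square)
  finally have EZ2: "expectation (\<lambda>\<omega>. (Z \<omega>)\<^sup>2) \<le> s + s\<^sup>2" .
  have N: "space M - (\<Union>f\<in>F. E f) \<in> events" using F by auto
  have "prob (space M - (\<Union>f\<in>F. E f)) = expectation (indicat_real (space M - (\<Union>f\<in>F. E f)))"
    using N by simp
  also have "\<dots> \<le> expectation (\<lambda>\<omega>. 1 - 2 / s * Z \<omega> + 1 / s\<^sup>2 * (Z \<omega>)\<^sup>2)"
  proof (rule integral_mono)
    show "integrable M (indicat_real (space M - (\<Union>f\<in>F. E f)))"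
      using N by (simp add: integrable_indicator_iff less_top[symmetric])
    show "integrable M (\<lambda>\<omega>. 1 - 2 / s * Z \<omega> + 1 / s\<^sup>2 * (Z \<omega>)\<^sup>2)"
      using iZ iZ2 by auto
    fix \<omega>
    have sq: "1 - 2 / s * Z \<omega> + 1 / s\<^sup>2 * (Z \<omega>)\<^sup>2 = (1 - Z \<omega> / s)\<^sup>2"
      by (simp add: power2_diff power_divide)
    show "indicat_real (space M - (\<Union>f\<in>F. E f)) \<omega> \<le> 1 - 2 / s * Z \<omega> + 1 / s\<^sup>2 * (Z \<omega>)\<^sup>2"
    proof (cases "\<omega> \<in> space M - (\<Union>f\<in>F. E f)")
      case True
      then have "Z \<omega> = 0" unfolding Z_def by (intro sum.neutral) auto
      then show ?thesis using True by simp
    next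
      case False
      then show ?thesis unfolding sq by simp
    qed
  qed
  also have "\<dots> = 1 - 2 / s * s + 1 / s\<^sup>2 * expectation (\<lambda>\<omega>. (Z \<omega>)\<^sup>2)"
    using iZ iZ2 EZ by (simp add: prob_space)
  also have "\<dots> \<le> 1 - 2 / s * s + 1 / s\<^sup>2 * (s + s\<^sup>2)"
    using EZ2 s(2) by (intro add_left_mono mult_left_mono) auto
  also have "\<dots> = 1 / s" using s(2) by (simp add: field_simps power2_eq_square)
  finally show ?thesis .
qed

lemma iid_prob_miss:
  fixes K A :: "'a::euclidean_space set" and X :: "nat \<Rightarrow> 'w \<Rightarrow> 'a"
  assumes iid: "iid_uniform_points P X N K" and K: "K \<in> fmeasurable lborel" "0 < emeasure lborel K"
    and A: "A \<in> sets borel" and N: "N > 0"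
  shows "{\<omega>\<in>space P. \<forall>i<N. X i \<omega> \<notin> A} \<in> sets P"
    "measure P {\<omega>\<in>space P. \<forall>i<N. X i \<omega> \<notin> A} = (1 - measure lborel (K \<inter> A) / measure lborel K) ^ N"
proof -
  interpret prob_space P using iid by (simp add: iid_uniform_points_def)
  have ind: "indep_vars (\<lambda>_. borel) X {..<N}" using iid by (simp add: iid_uniform_points_def)
  then have rv: "random_variable borel (X i)" if "i < N" for i
    using that by (simp add: indep_vars_def)
  have eq: "{\<omega>\<in>space P. \<forall>i<N. X i \<omega> \<notin> A} = (\<Inter>i\<in>{..<N}. X i -` (- A) \<inter> space P)"
    using N by auto
  have cA: "- A \<in> sets borel" using A by (metis Compl_eq_Diff_UNIV sets.compl_sets space_borel)
  show "{\<omega>\<in>space P. \<forall>i<N. X i \<omega> \<notin> A} \<in> sets P"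
    unfolding eq using N rv cA by (intro sets.finite_INT) (auto intro: measurable_sets)
  have pK: "measure lborel K > 0"
    using K by (metis emeasure_eq_measure2 ennreal_less_zero_iff fmeasurableD2 not_gr_zero measure_nonneg zero_less_measure_iff less_le)
  have one: "prob (X i -` (- A) \<inter> space P) = 1 - measure lborel (K \<inter> A) / measure lborel K" if "i < N" for i
  proof -
    have "prob (X i -` (- A) \<inter> space P) = measure (distr P borel (X i)) (- A)"
      using rv[OF that] cA by (simp add: measure_distr)
    also have "\<dots> = measure (uniform_measure lborel K) (- A)"
      using iid that by (simp add: iid_uniform_points_def)
    also have "\<dots> = measure lborel (K \<inter> - A) / measure lborel K"
      using K cA by (subst measure_uniform_measure) (auto dest: fmeasurableD2)
    also have "K \<inter> - A = K - K \<inter> A" by auto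
    also have "measure lborel (K - K \<inter> A) = measure lborel K - measure lborel (K \<inter> A)"
      using K A by (intro measure_Diff) (auto dest: fmeasurableD2 fmeasurableD)
    also have "(measure lborel K - measure lborel (K \<inter> A)) / measure lborel K = 1 - measure lborel (K \<inter> A) / measure lborel K"
      using pK by (simp add: diff_divide_distrib)
    finally show ?thesis .
  qed
  have "measure P {\<omega>\<in>space P. \<forall>i<N. X i \<omega> \<notin> A} = (\<Prod>i\<in>{..<N}. prob (X i -` (- A) \<inter> space P))"
    unfolding eq using N cA by (intro indep_varsD_finite[OF ind]) auto
  also have "\<dots> = (1 - measure lborel (K \<inter> A) / measure lborel K) ^ N" using one by simp
  finally show "measure P {\<omega>\<in>space P. \<forall>i<N. X i \<omega> \<notin> A} = (1 - measure lborel (K \<inter> A) / measure lborel K) ^ N" .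
qed

lemma covering_radius_gtD:
  assumes "K \<noteq> {}" "N > 0" "covering_radius x N K > r"
  obtains y where "y \<in> K" "\<And>j. j < N \<Longrightarrow> r < dist y (x j)"
proof -
  have "\<exists>y\<in>K. Min ((\<lambda>j. dist y (x j)) ` {..<N}) > r"
  proof (rule ccontr)
    assume "\<not> ?thesis"
    then have "covering_radius x N K \<le> r"
      unfolding covering_radius_def using assms(1) by (intro cSUP_least) (auto simp: not_less)
    then show False using assms(3) by simp
  qed
  then obtain y where y: "y \<in> K" "Min ((\<lambda>j. dist y (x j)) ` {..<N}) > r" by blast
  have "finite ((\<lambda>j. dist y (x j)) ` {..<N})" "(\<lambda>j. dist y (x j)) ` {..<N} \<noteq> {}"
    using assms(2) by (simp_all add: lessThan_empty_iff)
  then have "\<forall>a\<in>(\<lambda>j. dist y (x j)) ` {..<N}. r < a" using y(2) Min_gr_iff by blast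
  then show ?thesis using that[OF y(1)] by blast
qed

lemma bdd_above_min_dist:
  fixes K :: "'a::metric_space set" and N :: nat
  assumes "bounded K" "N > 0"
  shows "bdd_above ((\<lambda>y. Min ((\<lambda>j. dist y (x j)) ` {..<N})) ` K)"
proof -
  obtain e where e: "\<forall>y\<in>K. dist (x 0) y \<le> e" using assms(1) bounded_any_center by blast
  have "Min ((\<lambda>j. dist y (x j)) ` {..<N}) \<le> e" if "y \<in> K" for y
  proof -
    have "Min ((\<lambda>j. dist y (x j)) ` {..<N}) \<le> dist y (x 0)" using assms(2) by (intro Min_le) auto
    then show ?thesis using e that by (auto simp: dist_commute)
  qed
  then show ?thesis by (intro bdd_aboveI2)
qed

lemma covering_radius_geI:
  fixes K :: "'a::metric_space set"
  assumes "bounded K" "N > 0" "y \<in> K" "\<And>j. j < N \<Longrightarrow> r \<le> dist y (x j)"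
  shows "r \<le> covering_radius x N K"
proof -
  have "r \<le> Min ((\<lambda>j. dist y (x j)) ` {..<N})"
    using assms(2,4) by (subst Min_ge_iff) auto
  also have "\<dots> \<le> covering_radius x N K"
    unfolding covering_radius_def by (rule cSUP_upper[OF assms(3) bdd_above_min_dist[OF assms(1,2)]])
  finally show ?thesis .
qed

section \<open>Nets and packings adapted to the boundary\<close>

lemma UNIV_bounded_covering_order:
  fixes A :: "'a::euclidean_space set"
  assumes "bounded A"
  shows "covering_order DIM('a) A"
proof -
  obtain R where "A \<subseteq> ball 0 R" using assms bounded_subset_ballD by blast
  then have sub: "A \<subseteq> UNIV \<inter> ball 0 R" by simp
  have "covering_order DIM('a) (UNIV \<inter> ball (0::'a) R)"
    using subspace_ball_covering_order[OF subspace_UNIV, of "0::'a" R] by (simp only: dim_UNIV)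
  then show ?thesis using sub by (rule covering_order_subset)
qed

context smooth_body
begin

text \<open>
Points close to the boundary are few on the scale of their distance \<open>r\<close>: around each point of an \<open>r\<close>-net
of the boundary one places a rescaled copy of a fixed fine net \<open>G\<close> of a ball. The size of
\<open>G\<close> depends on \<open>\<eta>\<close> only and goes into the constant.
\<close>
lemma tube_cover:
  assumes \<eta>: "0 < \<eta>" "\<eta> \<le> 1"
  obtains C where "C > 0" "\<And>r. 0 < r \<Longrightarrow> r \<le> 1 \<Longrightarrow>
    \<exists>F. finite F \<and> F \<subseteq> {x\<in>K. ball x r \<inter> frontier K \<noteq> {}} \<and> real (card F) \<le> C / r ^ (DIM('a) - 1) \<and>
        {x\<in>K. ball x r \<inter> frontier K \<noteq> {}} \<subseteq> (\<Union>x\<in>F. cball x (\<eta> * r))"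
proof -
  obtain C where C: "C > 0" "\<And>\<delta>. 0 < \<delta> \<Longrightarrow> \<delta> \<le> 1 \<Longrightarrow>
     \<exists>F. finite F \<and> F \<subseteq> frontier K \<and> real (card F) \<le> C / \<delta> ^ (DIM('a) - 1) \<and> frontier K \<subseteq> (\<Union>x\<in>F. cball x \<delta>)"
    by (rule covering_orderE[OF hypersurface_covering_order[OF smooth compact_frontier]]) (rule that)
  obtain D where D: "D > 0" "\<And>\<delta>. 0 < \<delta> \<Longrightarrow> \<delta> \<le> 1 \<Longrightarrow>
     \<exists>F. finite F \<and> F \<subseteq> ball (0::'a) 3 \<and> real (card F) \<le> D / \<delta> ^ DIM('a) \<and> ball 0 3 \<subseteq> (\<Union>x\<in>F. cball x \<delta>)"
    by (rule covering_orderE[OF UNIV_bounded_covering_order[OF bounded_ball]]) (rule that)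
  have "0 < \<eta> / 2" "\<eta> / 2 \<le> 1" using \<eta> by auto
  from D(2)[OF this] obtain G where G: "finite G" "ball (0::'a) 3 \<subseteq> (\<Union>x\<in>G. cball x (\<eta> / 2))"
    by (elim exE conjE)
  define B where "B = C * (real (card G) + 1)"
  have "B > 0" using C by (simp add: B_def)
  moreover have "\<exists>F. finite F \<and> F \<subseteq> {x\<in>K. ball x r \<inter> frontier K \<noteq> {}} \<and> real (card F) \<le> B / r ^ (DIM('a) - 1) \<and>
        {x\<in>K. ball x r \<inter> frontier K \<noteq> {}} \<subseteq> (\<Union>x\<in>F. cball x (\<eta> * r))" if r: "0 < r" "r \<le> 1" for r
  proof -
    let ?T = "{x\<in>K. ball x r \<inter> frontier K \<noteq> {}}"
    from C(2)[OF r] obtain F where F: "finite F" "real (card F) \<le> C / r ^ (DIM('a) - 1)"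
      "frontier K \<subseteq> (\<Union>x\<in>F. cball x r)" by (elim exE conjE)
    define F' where "F' = (\<lambda>(f, g). f + r *\<^sub>R g) ` (F \<times> G)"
    have F': "finite F'" "card F' \<le> card F * card G"
      using card_image_le[of "F \<times> G" "\<lambda>(f, g). f + r *\<^sub>R g"] F(1) G(1) by (auto simp: F'_def card_cartesian_product)
    have sub: "?T \<subseteq> (\<Union>x\<in>F'. cball x (\<eta> * r / 2))"
    proof
      fix x assume "x \<in> ?T"
      then obtain q where q: "q \<in> frontier K" "dist x q < r" by auto
      then obtain f where f: "f \<in> F" "dist f q \<le> r" using F(3) by auto
      have "dist f x < 3 * r" using q f r dist_triangle[of f x q] by (simp add: dist_commute)
      then have "norm (x - f) / r < 3" using r by (simp add: dist_norm norm_minus_commute field_simps)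
      then have "(x - f) /\<^sub>R r \<in> ball 0 3" using r by (simp add: divide_inverse mult.commute)
      then obtain g where g: "g \<in> G" "(x - f) /\<^sub>R r \<in> cball g (\<eta> / 2)" using G(2) by blast
      have "f + r *\<^sub>R g - x = r *\<^sub>R (g - (x - f) /\<^sub>R r)" using r by (simp add: algebra_simps)
      then have "dist (f + r *\<^sub>R g) x = r * dist g ((x - f) /\<^sub>R r)" using r by (simp add: dist_norm)
      also have "\<dots> \<le> r * (\<eta> / 2)" using g(2) r by (intro mult_left_mono) auto
      finally have "x \<in> cball (f + r *\<^sub>R g) (\<eta> * r / 2)" by (simp add: mult_ac)
      moreover have "f + r *\<^sub>R g \<in> F'" using f g by (auto simp: F'_def)
      ultimately show "x \<in> (\<Union>x\<in>F'. cball x (\<eta> * r / 2))" by blast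
    qed
    obtain H where H: "finite H" "H \<subseteq> ?T" "card H \<le> card F'" "?T \<subseteq> (\<Union>x\<in>H. cball x (\<eta> * r))"
      using recenter_cover[OF F'(1) sub] .
    have "real (card H) \<le> real (card F * card G)" using H(3) F'(2) by (simp only: of_nat_le_iff)
    also have "\<dots> \<le> C / r ^ (DIM('a) - 1) * real (card G)"
      using F(2) unfolding of_nat_mult by (intro mult_right_mono) auto
    also have "\<dots> \<le> C / r ^ (DIM('a) - 1) * (real (card G) + 1)"
      using C r by (intro mult_left_mono) auto
    also have "\<dots> = B / r ^ (DIM('a) - 1)" by (simp add: B_def)
    finally show ?thesis using H(1,2,4) by (intro exI conjI)
  qed
  ultimately show ?thesis by (rule that)
qed

text \<open>
The net behind the union bound. An empty ball of radius \<open>r\<close> around any point of \<open>K\<close> contains an empty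
ball of the slightly smaller radius \<open>s\<close> around a net point. Net points in \<open>F1\<close> lie near the
boundary: there are few of them, but only half of their ball is guaranteed to lie in \<open>K\<close>. The
many points in \<open>F2\<close> are so far from the boundary that \<open>K\<close> contains their balls.
\<close>
lemma two_class_net:
  assumes \<theta>: "0 < \<theta>" "\<theta> < 1"
  obtains C r0 where "C > 0" "r0 > 0" "\<And>r. 0 < r \<Longrightarrow> r < r0 \<Longrightarrow>
    \<exists>F1 F2 s. finite F1 \<and> finite F2 \<and> real (card F1) \<le> C / r ^ (DIM('a) - 1) \<and> real (card F2) \<le> C / r ^ DIM('a) \<and>
      (\<forall>y\<in>K. \<exists>f\<in>F1 \<union> F2. ball f s \<subseteq> ball y r) \<and>
      (\<forall>f\<in>F1. \<theta> * unit_ball_vol (real DIM('a)) / 2 * r ^ DIM('a) \<le> measure lborel (K \<inter> ball f s)) \<and>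
      (\<forall>f\<in>F2. \<theta> * unit_ball_vol (real DIM('a)) * r ^ DIM('a) \<le> measure lborel (K \<inter> ball f s))"
proof -
  define N where "N = real DIM('a)"
  have N: "N \<ge> 1" by (simp add: N_def Suc_leI)
  \<comment> \<open>With this mesh Bernoulli's inequality bounds the volume lost by shrinking the balls.\<close>
  define \<eta> where "\<eta> = (1 - \<theta>) / (2 * N)"
  have \<eta>: "0 < \<eta>" "\<eta> \<le> 1 / 2" using \<theta> N by (auto simp: \<eta>_def field_simps)
  have pw: "(1 + \<theta>) / 2 \<le> (1 - \<eta>) ^ DIM('a)"
  proof -
    have "1 + real DIM('a) * (-\<eta>) \<le> (1 + (-\<eta>)) ^ DIM('a)"
      by (rule Bernoulli_inequality) (use \<eta> in auto)
    moreover have "1 + real DIM('a) * (-\<eta>) = (1 + \<theta>) / 2"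
      using N unfolding N_def[symmetric] by (simp add: \<eta>_def field_simps)
    ultimately show ?thesis by simp
  qed
  \<comment> \<open>The loss from the boundary and the loss from shrinking multiply to the factor \<open>\<theta>\<close>.\<close>
  define \<theta>' where "\<theta>' = 2 * \<theta> / (1 + \<theta>)"
  have \<theta>': "\<theta>' < 1" "0 < \<theta>'" "\<theta>' * ((1 + \<theta>) / 2) = \<theta>" using \<theta> by (auto simp: \<theta>'_def field_simps)
  have \<theta>1: "\<theta> \<le> \<theta>' * (1 - \<eta>) ^ DIM('a)"
    using mult_left_mono[OF pw, of \<theta>'] \<theta>'(2,3) by linarith
  have \<theta>2: "\<theta> \<le> (1 - \<eta>) ^ DIM('a)" by (rule order_trans[OF _ pw]) (use \<theta> in simp)
  obtain r1 where r1: "r1 > 0" "\<And>x r. x \<in> K \<Longrightarrow> 0 < r \<Longrightarrow> r < r1 \<Longrightarrow>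
      \<theta>' * unit_ball_vol (real DIM('a)) / 2 * r ^ DIM('a) \<le> measure lborel (K \<inter> ball x r)"
    by (rule volume_lower[OF \<theta>'(1)]) (rule that)
  have "0 < \<eta>" "\<eta> \<le> 1" using \<eta> by auto
  then obtain C1 where C1: "C1 > 0" "\<And>r. 0 < r \<Longrightarrow> r \<le> 1 \<Longrightarrow>
    \<exists>F. finite F \<and> F \<subseteq> {x\<in>K. ball x r \<inter> frontier K \<noteq> {}} \<and> real (card F) \<le> C1 / r ^ (DIM('a) - 1) \<and>
        {x\<in>K. ball x r \<inter> frontier K \<noteq> {}} \<subseteq> (\<Union>x\<in>F. cball x (\<eta> * r))"
    by (rule tube_cover) (rule that)
  obtain C2 where C2: "C2 > 0" "\<And>\<delta>. 0 < \<delta> \<Longrightarrow> \<delta> \<le> 1 \<Longrightarrow>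
     \<exists>F. finite F \<and> F \<subseteq> K \<and> real (card F) \<le> C2 / \<delta> ^ DIM('a) \<and> K \<subseteq> (\<Union>x\<in>F. cball x \<delta>)"
    by (rule covering_orderE[OF UNIV_bounded_covering_order[OF compact_imp_bounded[OF compact]]]) (rule that)
  define C where "C = max C1 (C2 * (2 / \<eta>) ^ DIM('a))"
  define r0 where "r0 = min r1 1"
  have "C > 0" "r0 > 0" using C1 r1 by (auto simp: C_def r0_def)
  moreover have "\<exists>F1 F2 s. finite F1 \<and> finite F2 \<and> real (card F1) \<le> C / r ^ (DIM('a) - 1) \<and> real (card F2) \<le> C / r ^ DIM('a) \<and>
      (\<forall>y\<in>K. \<exists>f\<in>F1 \<union> F2. ball f s \<subseteq> ball y r) \<and>
      (\<forall>f\<in>F1. \<theta> * unit_ball_vol (real DIM('a)) / 2 * r ^ DIM('a) \<le> measure lborel (K \<inter> ball f s)) \<and>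
      (\<forall>f\<in>F2. \<theta> * unit_ball_vol (real DIM('a)) * r ^ DIM('a) \<le> measure lborel (K \<inter> ball f s))"
    if r: "0 < r" "r < r0" for r
  proof -
    let ?T = "{x\<in>K. ball x r \<inter> frontier K \<noteq> {}}"
    have r': "r \<le> 1" "r < r1" using r by (auto simp: r0_def)
    from C1(2)[OF r(1) r'(1)] obtain F1 where F1: "finite F1" "F1 \<subseteq> ?T" "real (card F1) \<le> C1 / r ^ (DIM('a) - 1)"
        "?T \<subseteq> (\<Union>x\<in>F1. cball x (\<eta> * r))" by (elim exE conjE)
    have "0 < \<eta> * r / 2" using \<eta> r by simp
    moreover have "\<eta> * r / 2 \<le> 1" using mult_mono[of \<eta> 1 r 1] \<eta> r r' by auto
    ultimately have "\<exists>F. finite F \<and> F \<subseteq> K \<and> real (card F) \<le> C2 / (\<eta> * r / 2) ^ DIM('a) \<and> K \<subseteq> (\<Union>x\<in>F. cball x (\<eta> * r / 2))"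
      by (rule C2(2))
    then obtain F where F: "finite F" "real (card F) \<le> C2 / (\<eta> * r / 2) ^ DIM('a)"
        "K \<subseteq> (\<Union>x\<in>F. cball x (\<eta> * r / 2))" by (elim exE conjE)
    have sub: "K - ?T \<subseteq> (\<Union>x\<in>F. cball x (\<eta> * r / 2))" using F(3) by blast
    obtain F2 where F2: "finite F2" "F2 \<subseteq> K - ?T" "card F2 \<le> card F" "K - ?T \<subseteq> (\<Union>x\<in>F2. cball x (\<eta> * r))"
      using recenter_cover[OF F(1) sub] .
    define s where "s = (1 - \<eta>) * r"
    have s: "0 < s" "s \<le> r" using r \<eta> by (auto simp: s_def)
    have c1: "real (card F1) \<le> C / r ^ (DIM('a) - 1)"
    proof -
      have "C1 / r ^ (DIM('a) - 1) \<le> C / r ^ (DIM('a) - 1)" using r by (intro divide_right_mono) (auto simp: C_def)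
      then show ?thesis using F1(3) by linarith
    qed
    have c2: "real (card F2) \<le> C / r ^ DIM('a)"
    proof -
      have "real (card F2) \<le> real (card F)" using F2(3) by simp
      also have "\<dots> \<le> (C2 * (2 / \<eta>) ^ DIM('a)) / r ^ DIM('a)"
        using F(2) by (simp add: power_divide power_mult_distrib)
      also have "\<dots> \<le> C / r ^ DIM('a)" using r by (intro divide_right_mono) (auto simp: C_def)
      finally show ?thesis .
    qed
    have net: "\<exists>f\<in>F1 \<union> F2. ball f s \<subseteq> ball y r" if y: "y \<in> K" for y
    proof -
      have "\<exists>f\<in>F1 \<union> F2. dist f y \<le> \<eta> * r"
      proof (cases "y \<in> ?T")
        case True then show ?thesis using F1(4) by fastforce
      next
        case False then show ?thesis using F2(4) y by fastforce
      qed
      then obtain f where f: "f \<in> F1 \<union> F2" "dist f y \<le> \<eta> * r" by blast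
      have "ball f s \<subseteq> ball y r"
      proof
        fix z assume "z \<in> ball f s"
        then have "dist y z < \<eta> * r + s" using f dist_triangle[of y z f] by (simp add: dist_commute)
        then show "z \<in> ball y r" by (simp add: s_def left_diff_distrib)
      qed
      then show ?thesis using f by blast
    qed
    have sd: "s ^ DIM('a) = (1 - \<eta>) ^ DIM('a) * r ^ DIM('a)" by (simp add: s_def power_mult_distrib)
    have v1: "\<theta> * unit_ball_vol (real DIM('a)) / 2 * r ^ DIM('a) \<le> measure lborel (K \<inter> ball f s)" if f: "f \<in> F1" for f
    proof -
      have "\<theta> * (unit_ball_vol (real DIM('a)) / 2 * r ^ DIM('a)) \<le> (\<theta>' * (1 - \<eta>) ^ DIM('a)) * (unit_ball_vol (real DIM('a)) / 2 * r ^ DIM('a))"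
        using \<theta>1 r unit_ball_vol_nonneg[of "real DIM('a)"] by (intro mult_right_mono) auto
      also have "\<dots> = \<theta>' * unit_ball_vol (real DIM('a)) / 2 * s ^ DIM('a)" by (simp add: sd)
      also have "\<dots> \<le> measure lborel (K \<inter> ball f s)" using r1(2)[of f s] f F1(2) s r' by auto
      finally show ?thesis by simp
    qed
    have v2: "\<theta> * unit_ball_vol (real DIM('a)) * r ^ DIM('a) \<le> measure lborel (K \<inter> ball f s)" if f: "f \<in> F2" for f
    proof -
      have "\<theta> * (unit_ball_vol (real DIM('a)) * r ^ DIM('a)) \<le> (1 - \<eta>) ^ DIM('a) * (unit_ball_vol (real DIM('a)) * r ^ DIM('a))"
        using \<theta>2 r unit_ball_vol_nonneg[of "real DIM('a)"] by (intro mult_right_mono) auto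
      also have "\<dots> = unit_ball_vol (real DIM('a)) * s ^ DIM('a)" by (simp add: sd)
      also have "\<dots> = measure lborel (K \<inter> ball f s)"
      proof (rule volume_interior[symmetric])
        show "f \<in> K" using f F2(2) by blast
        have "ball f s \<subseteq> ball f r" using s(2) by (rule subset_ball)
        then show "ball f s \<inter> frontier K = {}" using f F2(2) by blast
      qed (rule s(1))
      finally show ?thesis by simp
    qed
    show ?thesis
      by (intro exI[of _ F1] exI[of _ F2] exI[of _ s] conjI ballI F1(1) F2(1) c1 c2 net v1 v2)
  qed
  ultimately show ?thesis by (rule that)
qed

lemma frontier_packing:
  assumes \<theta>: "\<theta> > 1"
  obtains c r0 where "c > 0" "r0 > 0" "\<And>r. 0 < r \<Longrightarrow> r < r0 \<Longrightarrow>
    \<exists>F. finite F \<and> F \<subseteq> frontier K \<and> c / r ^ (DIM('a) - 1) \<le> real (card F) \<and>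
      (\<forall>x\<in>F. \<forall>y\<in>F. x \<noteq> y \<longrightarrow> 2 * r \<le> dist x y) \<and>
      (\<forall>f\<in>F. measure lborel (K \<inter> ball f r) \<le> \<theta> * unit_ball_vol (real DIM('a)) / 2 * r ^ DIM('a))"
proof -
  obtain q where q: "q \<in> frontier K" using frontier_ne by blast
  obtain \<delta> where \<delta>: "\<delta> > 0" "\<forall>y\<in>frontier K \<inter> ball q \<delta>. \<forall>r. 0 < r \<and> r < \<delta> \<longrightarrow>
           measure lborel (K \<inter> ball y r) \<le> \<theta> * unit_ball_vol (real DIM('a)) / 2 * r ^ DIM('a)"
    using volume_at_frontier_upper[OF q \<theta>] by (elim exE conjE)
  obtain c where c: "c > 0" "\<And>t. t > 0 \<Longrightarrow> \<exists>F. finite F \<and> F \<subseteq> frontier K \<inter> ball q \<delta> \<and> c / t ^ (DIM('a) - 1) \<le> real (card F) \<and>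
      (\<forall>x\<in>F. \<forall>y\<in>F. x \<noteq> y \<longrightarrow> t \<le> dist x y)"
    by (rule hypersurface_packing[OF smooth q \<delta>(1)]) (rule that)
  have "\<exists>F. finite F \<and> F \<subseteq> frontier K \<and> (c / 2 ^ (DIM('a) - 1)) / r ^ (DIM('a) - 1) \<le> real (card F) \<and>
      (\<forall>x\<in>F. \<forall>y\<in>F. x \<noteq> y \<longrightarrow> 2 * r \<le> dist x y) \<and>
      (\<forall>f\<in>F. measure lborel (K \<inter> ball f r) \<le> \<theta> * unit_ball_vol (real DIM('a)) / 2 * r ^ DIM('a))"
    if r: "0 < r" "r < \<delta>" for r
  proof -
    have "2 * r > 0" using r by simp
    from c(2)[OF this] obtain F where F: "finite F" "F \<subseteq> frontier K \<inter> ball q \<delta>"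
      "c / (2 * r) ^ (DIM('a) - 1) \<le> real (card F)" "\<forall>x\<in>F. \<forall>y\<in>F. x \<noteq> y \<longrightarrow> 2 * r \<le> dist x y"
      by (elim exE conjE)
    show ?thesis
    proof (intro exI[of _ F] conjI ballI)
      show "finite F" "F \<subseteq> frontier K" using F by auto
      show "(c / 2 ^ (DIM('a) - 1)) / r ^ (DIM('a) - 1) \<le> real (card F)"
        using F(3) by (simp add: power_mult_distrib)
      show "x \<noteq> y \<longrightarrow> 2 * r \<le> dist x y" if "x \<in> F" "y \<in> F" for x y using F(4) that by blast
      show "measure lborel (K \<inter> ball f r) \<le> \<theta> * unit_ball_vol (real DIM('a)) / 2 * r ^ DIM('a)" if "f \<in> F" for f
        using \<delta>(2) F(2) r that by blast
    qed
  qed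
  then show ?thesis by (rule that[of "c / 2 ^ (DIM('a) - 1)" \<delta>, rotated 2]) (use c \<delta>(1) in simp_all)
qed

end

section \<open>Tail bounds for the covering radius\<close>

lemma one_minus_power_le_exp:
  fixes p a :: real
  assumes "a \<le> p" "p \<le> 1"
  shows "(1 - p) ^ N \<le> exp (- (a * real N))"
proof -
  have "(1 - p) ^ N \<le> exp (- a) ^ N"
    using assms exp_ge_add_one_self[of "-a"] by (intro power_mono) auto
  also have "\<dots> = exp (- (a * real N))" by (simp add: exp_of_nat_mult[symmetric] mult.commute)
  finally show ?thesis .
qed

text \<open>
The second order term of the logarithm is absorbed into \<open>\<kappa> > 1\<close> when \<open>x\<close> is small.
\<close>
lemma exp_le_one_minus_power:
  fixes x \<kappa> :: real
  assumes "0 \<le> x" "x \<le> 1 / 2" "2 * x \<le> \<kappa> - 1"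
  shows "exp (- (\<kappa> * x * real N)) \<le> (1 - x) ^ N"
proof -
  have "2 * x * x \<le> (\<kappa> - 1) * x" using assms by (intro mult_right_mono) auto
  then have "- (\<kappa> * x) \<le> - x - 2 * x\<^sup>2" by (simp add: power2_eq_square algebra_simps)
  also have "\<dots> \<le> ln (1 - x)" using ln_one_minus_pos_lower_bound assms by blast
  finally have "exp (- (\<kappa> * x)) \<le> exp (ln (1 - x))" by simp
  then have "exp (- (\<kappa> * x)) \<le> 1 - x" using assms by simp
  then have "exp (- (\<kappa> * x)) ^ N \<le> (1 - x) ^ N" by (intro power_mono) auto
  then show ?thesis by (simp add: exp_of_nat_mult[symmetric] mult.commute)
qed

context smooth_body
begin

lemma K_ne: "K \<noteq> {}" using pos by auto

lemma vol_pos: "measure lborel K > 0"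
  using pos K_meas by (metis emeasure_eq_measure2 ennreal_0 fmeasurableD2 less_numeral_extra(3) measure_nonneg order_le_less)

lemma iid_miss_event:
  fixes X :: "nat \<Rightarrow> 'w \<Rightarrow> 'a"
  assumes "iid_uniform_points P X N K" "N > 0" "A \<in> sets borel"
  shows "{\<omega>\<in>space P. \<forall>i<N. X i \<omega> \<notin> A} \<in> sets P"
    "measure P {\<omega>\<in>space P. \<forall>i<N. X i \<omega> \<notin> A} = (1 - measure lborel (K \<inter> A) / measure lborel K) ^ N"
  using iid_prob_miss[OF assms(1) K_meas pos assms(3,2)] by blast+

lemma measure_frac_le_1:
  assumes "A \<in> sets borel"
  shows "measure lborel (K \<inter> A) / measure lborel K \<le> 1"
proof -
  have "measure lborel (K \<inter> A) \<le> measure lborel K"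
    using K_meas assms by (intro measure_mono_fmeasurable) (auto dest: fmeasurableD)
  then show ?thesis using vol_pos by simp
qed

text \<open>
Union bound over the balls of the two-class net.
\<close>
lemma prob_covering_radius_gt:
  assumes \<theta>: "0 < \<theta>" "\<theta> < 1"
  obtains C r0 where "C > 0" "r0 > 0"
    "\<And>(P :: 'w measure) X N r. iid_uniform_points P X N K \<Longrightarrow> N > 0 \<Longrightarrow> 0 < r \<Longrightarrow> r < r0 \<Longrightarrow>
      measure P {\<omega>\<in>space P. r < covering_radius (\<lambda>j. X j \<omega>) N K} \<le>
        C / r ^ (DIM('a) - 1) * exp (- (\<theta> * unit_ball_vol (real DIM('a)) / 2 * r ^ DIM('a) / measure lborel K * real N)) +
        C / r ^ DIM('a) * exp (- (\<theta> * unit_ball_vol (real DIM('a)) * r ^ DIM('a) / measure lborel K * real N))"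
proof -
  obtain C r0 where C: "C > 0" "r0 > 0" and net: "\<And>r. 0 < r \<Longrightarrow> r < r0 \<Longrightarrow>
    \<exists>F1 F2 s. finite F1 \<and> finite F2 \<and> real (card F1) \<le> C / r ^ (DIM('a) - 1) \<and> real (card F2) \<le> C / r ^ DIM('a) \<and>
      (\<forall>y\<in>K. \<exists>f\<in>F1 \<union> F2. ball f s \<subseteq> ball y r) \<and>
      (\<forall>f\<in>F1. \<theta> * unit_ball_vol (real DIM('a)) / 2 * r ^ DIM('a) \<le> measure lborel (K \<inter> ball f s)) \<and>
      (\<forall>f\<in>F2. \<theta> * unit_ball_vol (real DIM('a)) * r ^ DIM('a) \<le> measure lborel (K \<inter> ball f s))"
    by (rule two_class_net[OF \<theta>]) (rule that)
  have "measure P {\<omega>\<in>space P. r < covering_radius (\<lambda>j. X j \<omega>) N K} \<le>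
        C / r ^ (DIM('a) - 1) * exp (- (\<theta> * unit_ball_vol (real DIM('a)) / 2 * r ^ DIM('a) / measure lborel K * real N)) +
        C / r ^ DIM('a) * exp (- (\<theta> * unit_ball_vol (real DIM('a)) * r ^ DIM('a) / measure lborel K * real N))"
    if iid: "iid_uniform_points P X N K" and N: "N > 0" and r: "0 < r" "r < r0"
    for P :: "'w measure" and X N r
  proof -
    interpret prob_space P using iid by (simp add: iid_uniform_points_def)
    from net[OF r] obtain F1 F2 s where F: "finite F1" "finite F2" "real (card F1) \<le> C / r ^ (DIM('a) - 1)" "real (card F2) \<le> C / r ^ DIM('a)"
      "\<forall>y\<in>K. \<exists>f\<in>F1 \<union> F2. ball f s \<subseteq> ball y r"
      "\<forall>f\<in>F1. \<theta> * unit_ball_vol (real DIM('a)) / 2 * r ^ DIM('a) \<le> measure lborel (K \<inter> ball f s)"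
      "\<forall>f\<in>F2. \<theta> * unit_ball_vol (real DIM('a)) * r ^ DIM('a) \<le> measure lborel (K \<inter> ball f s)"
      by (elim exE conjE)
    define E where "E = (\<lambda>f. {\<omega>\<in>space P. \<forall>i<N. X i \<omega> \<notin> ball f s})"
    have E: "E f \<in> sets P" "measure P (E f) = (1 - measure lborel (K \<inter> ball f s) / measure lborel K) ^ N" for f
      unfolding E_def by (rule iid_miss_event[OF iid N], simp)+
    have ev: "(\<Union>f\<in>G. E f) \<in> sets P" if "finite G" for G
      using that E(1) by (rule sets.finite_UN)
    have bound: "measure P (\<Union>f\<in>G. E f) \<le> B * exp (- (a / measure lborel K * real N))"
      if G: "finite G" "real (card G) \<le> B" "\<forall>f\<in>G. a \<le> measure lborel (K \<inter> ball f s)" for G a B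
    proof -
      have "measure P (\<Union>f\<in>G. E f) \<le> (\<Sum>f\<in>G. measure P (E f))"
        using G E by (intro finite_measure_subadditive_finite) auto
      also have "\<dots> \<le> real (card G) * exp (- (a / measure lborel K * real N))"
      proof (rule sum_bounded_above)
        fix f assume "f \<in> G"
        then have "a / measure lborel K \<le> measure lborel (K \<inter> ball f s) / measure lborel K"
          using G(3) vol_pos by (intro divide_right_mono) auto
        then show "measure P (E f) \<le> exp (- (a / measure lborel K * real N))"
          unfolding E(2) by (rule one_minus_power_le_exp) (simp add: measure_frac_le_1)
      qed
      also have "\<dots> \<le> B * exp (- (a / measure lborel K * real N))"
        using G(2) by (rule mult_right_mono) simp
      finally show ?thesis .
    qed
    have "{\<omega>\<in>space P. r < covering_radius (\<lambda>j. X j \<omega>) N K} \<subseteq> (\<Union>f\<in>F1. E f) \<union> (\<Union>f\<in>F2. E f)"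
    proof
      fix \<omega> assume w: "\<omega> \<in> {\<omega>\<in>space P. r < covering_radius (\<lambda>j. X j \<omega>) N K}"
      then have "r < covering_radius (\<lambda>j. X j \<omega>) N K" by simp
      from covering_radius_gtD[OF K_ne N this] obtain y where y: "y \<in> K" "\<And>j. j < N \<Longrightarrow> r < dist y (X j \<omega>)" by blast
      obtain f where f: "f \<in> F1 \<union> F2" "ball f s \<subseteq> ball y r" using F(5) y(1) by blast
      have "X i \<omega> \<notin> ball f s" if "i < N" for i
        using f(2) y(2)[OF that] by auto
      then have "\<omega> \<in> E f" using w by (simp add: E_def)
      then show "\<omega> \<in> (\<Union>f\<in>F1. E f) \<union> (\<Union>f\<in>F2. E f)" using f(1) by blast
    qed
    then have "measure P {\<omega>\<in>space P. r < covering_radius (\<lambda>j. X j \<omega>) N K} \<le> measure P ((\<Union>f\<in>F1. E f) \<union> (\<Union>f\<in>F2. E f))"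
      by (rule finite_measure_mono) (intro sets.Un ev F)
    also have "\<dots> \<le> measure P (\<Union>f\<in>F1. E f) + measure P (\<Union>f\<in>F2. E f)"
      by (intro measure_Un_le ev F)
    also have "\<dots> \<le> C / r ^ (DIM('a) - 1) * exp (- (\<theta> * unit_ball_vol (real DIM('a)) / 2 * r ^ DIM('a) / measure lborel K * real N)) +
        C / r ^ DIM('a) * exp (- (\<theta> * unit_ball_vol (real DIM('a)) * r ^ DIM('a) / measure lborel K * real N))"
      by (intro add_mono bound F)
    finally show ?thesis .
  qed
  with C show ?thesis by (rule that)
qed

text \<open>
If one of the disjoint balls around boundary points contains no random point, then its centre
witnesses a covering radius of at least \<open>r\<close>. Two disjoint balls compete for the points, so the
events that they are empty are negatively correlated.
\<close>
lemma prob_covering_radius_lt: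
  assumes \<theta>: "\<theta> > 1"
  obtains C r0 where "C > 0" "r0 > 0"
    "\<And>(P :: 'w measure) X N r. iid_uniform_points P X N K \<Longrightarrow> N > 0 \<Longrightarrow> 0 < r \<Longrightarrow> r < r0 \<Longrightarrow>
      measure P {\<omega>\<in>space P. covering_radius (\<lambda>j. X j \<omega>) N K < r} \<le>
        C * r ^ (DIM('a) - 1) * exp (\<theta> * unit_ball_vol (real DIM('a)) / 2 * r ^ DIM('a) / measure lborel K * real N)"
proof -
  \<comment> \<open>One factor \<open>\<kappa>\<close> pays for the volume of the balls, the other one for passing to the exponential.\<close>
  define \<kappa> where "\<kappa> = sqrt \<theta>"
  have \<kappa>: "\<kappa> > 1" "\<kappa> * \<kappa> = \<theta>" using \<theta> by (auto simp: \<kappa>_def)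
  obtain c r1 where c: "c > 0" "r1 > 0" and pack: "\<And>r. 0 < r \<Longrightarrow> r < r1 \<Longrightarrow>
    \<exists>F. finite F \<and> F \<subseteq> frontier K \<and> c / r ^ (DIM('a) - 1) \<le> real (card F) \<and>
      (\<forall>x\<in>F. \<forall>y\<in>F. x \<noteq> y \<longrightarrow> 2 * r \<le> dist x y) \<and>
      (\<forall>f\<in>F. measure lborel (K \<inter> ball f r) \<le> \<kappa> * unit_ball_vol (real DIM('a)) / 2 * r ^ DIM('a))"
    by (rule frontier_packing[OF \<kappa>(1)]) (rule that)
  define B where "B = \<kappa> * unit_ball_vol (real DIM('a)) / 2 / measure lborel K"
  have B: "B > 0" using \<kappa> vol_pos by (simp add: B_def unit_ball_vol_pos)
  \<comment> \<open>Radii below \<open>b\<close> make the probability of hitting a ball small enough for the exponential lower bound.\<close>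
  define b where "b = min (1 / 2) ((\<kappa> - 1) / 2) / B"
  define r0 where "r0 = min r1 (min 1 b)"
  have b: "b > 0" using \<kappa> B by (simp add: b_def)
  have r0: "r0 > 0" using c b by (simp add: r0_def)
  have "measure P {\<omega>\<in>space P. covering_radius (\<lambda>j. X j \<omega>) N K < r} \<le>
        1 / c * r ^ (DIM('a) - 1) * exp (\<theta> * unit_ball_vol (real DIM('a)) / 2 * r ^ DIM('a) / measure lborel K * real N)"
    if iid: "iid_uniform_points P X N K" and N: "N > 0" and r: "0 < r" "r < r0"
    for P :: "'w measure" and X N r
  proof -
    interpret prob_space P using iid by (simp add: iid_uniform_points_def)
    have r': "r < r1" "r \<le> 1" "r < b" using r by (auto simp: r0_def)
    from pack[OF r(1) r'(1)] obtain F where F: "finite F" "F \<subseteq> frontier K" "c / r ^ (DIM('a) - 1) \<le> real (card F)"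
      "\<forall>x\<in>F. \<forall>y\<in>F. x \<noteq> y \<longrightarrow> 2 * r \<le> dist x y"
      "\<forall>f\<in>F. measure lborel (K \<inter> ball f r) \<le> \<kappa> * unit_ball_vol (real DIM('a)) / 2 * r ^ DIM('a)"
      by (elim exE conjE)
    define E where "E = (\<lambda>f. {\<omega>\<in>space P. \<forall>i<N. X i \<omega> \<notin> ball f r})"
    define p where "p = (\<lambda>f. measure lborel (K \<inter> ball f r) / measure lborel K)"
    have E: "E f \<in> sets P" "measure P (E f) = (1 - p f) ^ N" for f
      unfolding E_def p_def by (rule iid_miss_event[OF iid N], simp)+
    have ev: "(\<Union>f\<in>G. E f) \<in> sets P" if "finite G" for G
      using that E(1) by (rule sets.finite_UN)
    define x where "x = B * r ^ DIM('a)"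
    have "r ^ DIM('a) \<le> r" using r r' power_decreasing[of 1 "DIM('a)" r] by (simp add: Suc_leI)
    then have "x \<le> B * b" using B r' unfolding x_def by (intro mult_left_mono) auto
    then have x: "0 \<le> x" "x \<le> 1 / 2" "2 * x \<le> \<kappa> - 1" using B r by (auto simp: x_def b_def)
    have px: "p f \<le> x" if "f \<in> F" for f
    proof -
      have "p f \<le> (\<kappa> * unit_ball_vol (real DIM('a)) / 2 * r ^ DIM('a)) / measure lborel K"
        unfolding p_def using F(5) that vol_pos by (intro divide_right_mono) auto
      then show ?thesis by (simp add: x_def B_def)
    qed
    define s where "s = (\<Sum>f\<in>F. measure P (E f))"
    have s: "c / r ^ (DIM('a) - 1) * exp (- (\<kappa> * x * real N)) \<le> s"
    proof -
      have "c / r ^ (DIM('a) - 1) * exp (- (\<kappa> * x * real N)) \<le> real (card F) * exp (- (\<kappa> * x * real N))"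
        using F(3) by (rule mult_right_mono) simp
      also have "\<dots> \<le> s" unfolding s_def
      proof (rule sum_bounded_below)
        fix f assume f: "f \<in> F"
        have "exp (- (\<kappa> * x * real N)) \<le> (1 - x) ^ N" by (rule exp_le_one_minus_power[OF x])
        also have "\<dots> \<le> (1 - p f) ^ N" using px[OF f] x by (intro power_mono) auto
        finally show "exp (- (\<kappa> * x * real N)) \<le> measure P (E f)" by (simp add: E)
      qed
      finally show ?thesis .
    qed
    have pos: "0 < c / r ^ (DIM('a) - 1) * exp (- (\<kappa> * x * real N))" using c r by simp
    have neg: "measure P (E f \<inter> E g) \<le> measure P (E f) * measure P (E g)" if fg: "f \<in> F" "g \<in> F" "f \<noteq> g" for f g
    proof -
      have disj: "ball f r \<inter> ball g r = {}"
        using F(4) fg by (intro disjoint_ballI) (fastforce simp: dist_commute)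
      have "E f \<inter> E g = {\<omega>\<in>space P. \<forall>i<N. X i \<omega> \<notin> ball f r \<union> ball g r}" by (auto simp: E_def)
      then have "measure P (E f \<inter> E g) = (1 - measure lborel (K \<inter> (ball f r \<union> ball g r)) / measure lborel K) ^ N"
        using iid_miss_event(2)[OF iid N, of "ball f r \<union> ball g r"] by simp
      also have "measure lborel (K \<inter> (ball f r \<union> ball g r)) = measure lborel (K \<inter> ball f r) + measure lborel (K \<inter> ball g r)"
        unfolding Int_Un_distrib
        using meas_K_Int_ball[of f r] meas_K_Int_ball[of g r] disj
        by (intro measure_Union) (auto dest: fmeasurableD fmeasurableD2)
      finally have eq: "measure P (E f \<inter> E g) = (1 - (p f + p g)) ^ N" by (simp add: p_def add_divide_distrib)
      have p0: "p f \<ge> 0" "p g \<ge> 0" by (auto simp: p_def)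
      have "(1 - (p f + p g)) ^ N \<le> ((1 - p f) * (1 - p g)) ^ N"
        using px[OF fg(1)] px[OF fg(2)] x p0 by (intro power_mono) (auto simp: algebra_simps)
      then show ?thesis unfolding eq E by (simp add: power_mult_distrib)
    qed
    have "{\<omega>\<in>space P. covering_radius (\<lambda>j. X j \<omega>) N K < r} \<subseteq> space P - (\<Union>f\<in>F. E f)"
    proof
      fix \<omega> assume w: "\<omega> \<in> {\<omega>\<in>space P. covering_radius (\<lambda>j. X j \<omega>) N K < r}"
      have "\<omega> \<notin> E f" if f: "f \<in> F" for f
      proof
        assume "\<omega> \<in> E f"
        then have "\<And>j. j < N \<Longrightarrow> r \<le> dist f (X j \<omega>)" by (auto simp: E_def not_less)
        then have "r \<le> covering_radius (\<lambda>j. X j \<omega>) N K"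
          using f F(2) frontier_sub compact_imp_bounded[OF compact] N by (intro covering_radius_geI[of K N f]) auto
        then show False using w by simp
      qed
      then show "\<omega> \<in> space P - (\<Union>f\<in>F. E f)" using w by blast
    qed
    then have "measure P {\<omega>\<in>space P. covering_radius (\<lambda>j. X j \<omega>) N K < r} \<le> measure P (space P - (\<Union>f\<in>F. E f))"
      by (rule finite_measure_mono) (intro sets.compl_sets ev F)
    also have "\<dots> \<le> 1 / s"
      by (rule prob_none_le_inverse_sum[OF F(1) E(1) neg s_def]) (use less_le_trans[OF pos s] in auto)
    also have "\<dots> \<le> 1 / (c / r ^ (DIM('a) - 1) * exp (- (\<kappa> * x * real N)))"
      by (rule divide_left_mono[OF s _ mult_pos_pos[OF less_le_trans[OF pos s] pos]]) simp
    also have "\<dots> = 1 / c * r ^ (DIM('a) - 1) * exp (\<kappa> * x * real N)"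
      by (simp add: exp_minus field_simps)
    also have "\<kappa> * x = \<theta> * unit_ball_vol (real DIM('a)) / 2 * r ^ DIM('a) / measure lborel K"
      using \<kappa>(2) by (simp add: x_def B_def)
    finally show ?thesis .
  qed
  then show ?thesis by (rule that[of "1 / c" r0, rotated 2]) (use c r0 in simp_all)
qed

end

section \<open>Measurability and moments\<close>

text \<open>
The points within distance \<open>s\<close> of the configuration form a closed set, so it suffices to test a
dense subset. A countable one makes the covering radius measurable.
\<close>
lemma covering_radius_dense:
  fixes K :: "'a::metric_space set" and N :: nat
  assumes K: "bounded K" "K \<noteq> {}" and N: "N > 0" and D: "D \<subseteq> K" "K \<subseteq> closure D"
  shows "covering_radius x N K = covering_radius x N D"
proof (rule antisym)
  let ?m = "\<lambda>y. Min ((\<lambda>j. dist y (x j)) ` {..<N})"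
  define s where "s = covering_radius x N D"
  have ne: "D \<noteq> {}" using K D by auto
  have bD: "bdd_above (?m ` D)" using bdd_above_min_dist[OF bounded_subset[OF K(1) D(1)] N] .
  show "covering_radius x N D \<le> covering_radius x N K"
    unfolding covering_radius_def[of x N D]
  proof (rule cSUP_least[OF ne])
    fix y assume y: "y \<in> D"
    show "?m y \<le> covering_radius x N K"
      unfolding covering_radius_def
      by (rule cSUP_upper[OF _ bdd_above_min_dist[OF K(1) N]]) (use y D in auto)
  qed
  have "D \<subseteq> (\<Union>j<N. cball (x j) s)"
  proof
    fix y assume y: "y \<in> D"
    have le: "?m y \<le> s" unfolding s_def covering_radius_def by (rule cSUP_upper[OF y bD])
    have "?m y \<in> (\<lambda>j. dist y (x j)) ` {..<N}" using N by (intro Min_in) auto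
    then obtain j where "j < N" "?m y = dist y (x j)" by auto
    then show "y \<in> (\<Union>j<N. cball (x j) s)" using le by (auto simp: dist_commute)
  qed
  then have cl: "closure D \<subseteq> (\<Union>j<N. cball (x j) s)" by (intro closure_minimal) auto
  show "covering_radius x N K \<le> covering_radius x N D"
    unfolding covering_radius_def[of x N K] s_def[symmetric]
  proof (rule cSUP_least[OF K(2)])
    fix y assume "y \<in> K"
    then obtain j where j: "j < N" "dist (x j) y \<le> s" using cl D(2) by auto
    have "?m y \<le> dist y (x j)" using j by (intro Min_le) auto
    also have "\<dots> \<le> s" using j by (simp add: dist_commute)
    finally show "?m y \<le> s" .
  qed
qed

lemma covering_radius_borel_measurable:
  fixes K :: "'a::euclidean_space set" and X :: "nat \<Rightarrow> 'w \<Rightarrow> 'a"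
  assumes K: "bounded K" "K \<noteq> {}" and N: "N > 0" and X: "\<And>j. j < N \<Longrightarrow> X j \<in> borel_measurable M"
  shows "(\<lambda>\<omega>. covering_radius (\<lambda>j. X j \<omega>) N K) \<in> borel_measurable M"
proof -
  obtain D where D: "countable D" "D \<subseteq> K" "K \<subseteq> closure D" using separable .
  have "(\<lambda>\<omega>. SUP y\<in>D. Min ((\<lambda>j. dist y (X j \<omega>)) ` {..<N})) \<in> borel_measurable M"
  proof (rule borel_measurable_cSUP[OF D(1)])
    show "(\<lambda>\<omega>. Min ((\<lambda>j. dist y (X j \<omega>)) ` {..<N})) \<in> borel_measurable M" for y
      using X by (intro borel_measurable_Min borel_measurable_dist) auto
    show "bdd_above ((\<lambda>y. Min ((\<lambda>j. dist y (X j \<omega>)) ` {..<N})) ` D)" for \<omega>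
      using bdd_above_min_dist[OF bounded_subset[OF K(1) D(2)] N] .
  qed
  then show ?thesis
    unfolding covering_radius_dense[OF K N D(2,3)] by (simp only: covering_radius_def)
qed

lemma iid_covering_radius_bounds:
  fixes K :: "'a::euclidean_space set" and X :: "nat \<Rightarrow> 'w \<Rightarrow> 'a"
  assumes iid: "iid_uniform_points P X N K" and K: "compact K" "K \<noteq> {}" and N: "N > 0"
  shows "(\<lambda>\<omega>. covering_radius (\<lambda>j. X j \<omega>) N K) \<in> borel_measurable P"
    "AE \<omega> in P. 0 \<le> covering_radius (\<lambda>j. X j \<omega>) N K \<and> covering_radius (\<lambda>j. X j \<omega>) N K \<le> diameter K"
proof -
  interpret prob_space P using iid by (simp add: iid_uniform_points_def)
  have "indep_vars (\<lambda>_. borel) X {..<N}" using iid by (simp add: iid_uniform_points_def)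
  then have rv: "X i \<in> borel_measurable P" if "i < N" for i
    using that by (simp add: indep_vars_def)
  have bK: "bounded K" using K compact_imp_bounded by blast
  show "(\<lambda>\<omega>. covering_radius (\<lambda>j. X j \<omega>) N K) \<in> borel_measurable P"
    by (rule covering_radius_borel_measurable[OF bK K(2) N rv])
  have "AE x in distr P borel (X 0). x \<in> K"
  proof -
    have "AE x in uniform_measure lborel K. x \<in> K"
      using K by (intro AE_uniform_measureI) (auto intro: borel_compact)
    moreover have "distr P borel (X 0) = uniform_measure lborel K"
      using iid N unfolding iid_uniform_points_def by blast
    ultimately show ?thesis by (simp only:)
  qed
  then have "AE \<omega> in P. X 0 \<omega> \<in> K" by (rule AE_distrD[OF rv[OF N]])
  then show "AE \<omega> in P. 0 \<le> covering_radius (\<lambda>j. X j \<omega>) N K \<and> covering_radius (\<lambda>j. X j \<omega>) N K \<le> diameter K"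
  proof (rule AE_mp, intro AE_I2 impI conjI)
    fix \<omega> assume w: "X 0 \<omega> \<in> K"
    obtain y where "y \<in> K" using K by blast
    then show "0 \<le> covering_radius (\<lambda>j. X j \<omega>) N K"
      by (rule covering_radius_geI[OF bK N]) simp
    show "covering_radius (\<lambda>j. X j \<omega>) N K \<le> diameter K"
      unfolding covering_radius_def
    proof (rule cSUP_least[OF K(2)])
      fix y assume y: "y \<in> K"
      have "Min ((\<lambda>j. dist y (X j \<omega>)) ` {..<N}) \<le> dist y (X 0 \<omega>)" using N by (intro Min_le) auto
      also have "\<dots> \<le> diameter K" by (rule diameter_bounded_bound[OF bK y w])
      finally show "Min ((\<lambda>j. dist y (X j \<omega>)) ` {..<N}) \<le> diameter K" .
    qed
  qed
qed

text \<open>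
The upper bound splits the expectation at \<open>r1\<close> and \<open>r2\<close>. It is used with \<open>r1\<close> just above the
threshold and \<open>r2\<close> a large multiple of it, where the tail is small enough to pay for the trivial bound \<open>D\<close>.
\<close>
lemma (in prob_space) moment_bounds:
  fixes R :: "'a \<Rightarrow> real"
  assumes R: "R \<in> borel_measurable M" "AE \<omega> in M. 0 \<le> R \<omega> \<and> R \<omega> \<le> D" and p: "p \<ge> 0"
  shows moment_upper: "0 \<le> r1 \<Longrightarrow> 0 \<le> r2 \<Longrightarrow> expectation (\<lambda>\<omega>. R \<omega> powr p) \<le>
      r1 powr p + r2 powr p * prob {\<omega>\<in>space M. r1 < R \<omega>} + D powr p * prob {\<omega>\<in>space M. r2 < R \<omega>}"
    and moment_lower: "0 \<le> r \<Longrightarrow> r powr p * (1 - prob {\<omega>\<in>space M. R \<omega> < r}) \<le> expectation (\<lambda>\<omega>. R \<omega> powr p)"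
proof -
  have int: "integrable M (\<lambda>\<omega>. R \<omega> powr p)"
  proof (rule integrable_const_bound[where B = "D powr p"])
    show "AE \<omega> in M. norm (R \<omega> powr p) \<le> D powr p"
      using R(2) by (rule AE_mp) (auto intro!: AE_I2 powr_mono2 p)
  qed (use R(1) in simp)
  have ev: "{\<omega>\<in>space M. s < R \<omega>} \<in> events" "{\<omega>\<in>space M. R \<omega> < s} \<in> events" for s
    using R(1) by measurable
  have ind: "integrable M (indicat_real A)" if "A \<in> events" for A
    using that by (simp add: integrable_indicator_iff less_top[symmetric])
  show "expectation (\<lambda>\<omega>. R \<omega> powr p) \<le>
      r1 powr p + r2 powr p * prob {\<omega>\<in>space M. r1 < R \<omega>} + D powr p * prob {\<omega>\<in>space M. r2 < R \<omega>}"
    if r: "0 \<le> r1" "0 \<le> r2"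
  proof -
    let ?g = "\<lambda>\<omega>. r1 powr p + r2 powr p * indicat_real {\<omega>\<in>space M. r1 < R \<omega>} \<omega> + D powr p * indicat_real {\<omega>\<in>space M. r2 < R \<omega>} \<omega>"
    have intg: "integrable M ?g" using ind[OF ev(1)] by auto
    have "expectation (\<lambda>\<omega>. R \<omega> powr p) \<le> expectation ?g"
    proof (rule integral_mono_AE[OF int intg])
      show "AE \<omega> in M. R \<omega> powr p \<le> ?g \<omega>"
        using R(2)
      proof (rule AE_mp, intro AE_I2 impI)
        fix \<omega> assume w: "\<omega> \<in> space M" "0 \<le> R \<omega> \<and> R \<omega> \<le> D"
        consider "R \<omega> \<le> r1" | "r1 < R \<omega>" "R \<omega> \<le> r2" | "r2 < R \<omega>" by linarith
        then show "R \<omega> powr p \<le> ?g \<omega>"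
        proof cases
          case 1
          then have "R \<omega> powr p \<le> r1 powr p" using w p by (intro powr_mono2) auto
          then show ?thesis by (simp add: add_increasing2)
        next
          case 2
          then have "R \<omega> powr p \<le> r2 powr p" using w p by (intro powr_mono2) auto
          then show ?thesis using w 2 by (simp add: add_increasing2 add_increasing)
        next
          case 3
          then have "R \<omega> powr p \<le> D powr p" using w p by (intro powr_mono2) auto
          then show ?thesis using w 3 by (simp add: add_increasing)
        qed
      qed
    qed
    also have "expectation ?g = r1 powr p + r2 powr p * prob {\<omega>\<in>space M. r1 < R \<omega>} + D powr p * prob {\<omega>\<in>space M. r2 < R \<omega>}"
      using ind[OF ev(1)] ev(1) by (simp add: prob_space)
    finally show ?thesis .
  qed
  show "r powr p * (1 - prob {\<omega>\<in>space M. R \<omega> < r}) \<le> expectation (\<lambda>\<omega>. R \<omega> powr p)" if r: "0 \<le> r"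
  proof -
    let ?A = "space M - {\<omega>\<in>space M. R \<omega> < r}"
    have A: "?A \<in> events" using ev(2) by blast
    have "r powr p * (1 - prob {\<omega>\<in>space M. R \<omega> < r}) = expectation (\<lambda>\<omega>. r powr p * indicat_real ?A \<omega>)"
      using A ev(2) by (simp add: prob_compl)
    also have "\<dots> \<le> expectation (\<lambda>\<omega>. R \<omega> powr p)"
    proof (rule integral_mono)
      show "integrable M (\<lambda>\<omega>. r powr p * indicat_real ?A \<omega>)" using ind[OF A] by simp
      show "r powr p * indicat_real ?A \<omega> \<le> R \<omega> powr p" for \<omega>
        using r p by (auto simp: indicator_def not_less intro: powr_mono2)
    qed (rule int)
    finally show ?thesis .
  qed
qed

lemma union_bound_asymptotics:
  fixes c e q s :: real
  assumes "s > 0" "c > 0"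
  shows "(\<lambda>N. (real N / ln (real N)) powr q * ((c * ln (real N) / real N) powr (- e) * exp (- ((e + q + s) * ln (real N))))) \<longlonglongrightarrow> 0"
proof -
  have "(\<lambda>N. c powr (- e) * (ln (real N) powr (- q - e) * real N powr (- s))) \<longlonglongrightarrow> c powr (- e) * 0"
    using assms by (intro tendsto_mult_left) real_asymp
  moreover have "\<forall>\<^sub>F N in sequentially. c powr (- e) * (ln (real N) powr (- q - e) * real N powr (- s)) =
     (real N / ln (real N)) powr q * ((c * ln (real N) / real N) powr (- e) * exp (- ((e + q + s) * ln (real N))))"
    using eventually_ge_at_top[of "2::nat"]
  proof eventually_elim
    case (elim N)
    then have l: "ln (real N) > 0" "real N > 0" by auto
    then show ?case
      using assms by (simp add: powr_def ln_mult ln_div exp_add[symmetric] algebra_simps)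
  qed
  ultimately show ?thesis by (simp add: tendsto_cong)
qed


section \<open>The limit of the moments\<close>

text \<open>
The radius for which \<open>N\<close> times the \<open>d\<close>-th power of the radius is \<open>c * ln N\<close>, so that exponentials of
\<open>N * r ^ d\<close> become powers of \<open>N\<close>.
\<close>
definition log_radius :: "nat \<Rightarrow> real \<Rightarrow> nat \<Rightarrow> real" where
  "log_radius d c N = (c * ln (real N) / real N) powr (1 / real d)"

context smooth_body
begin

lemma log_radius_powers:
  assumes c: "c > 0" and N: "N \<ge> 2"
  shows "log_radius DIM('a) c N > 0"
    and "log_radius DIM('a) c N ^ DIM('a) = c * ln (real N) / real N"
    and "log_radius DIM('a) c N ^ (DIM('a) - 1) = (c * ln (real N) / real N) powr ((real DIM('a) - 1) / real DIM('a))"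
    and "log_radius DIM('a) c N powr p * (real N / ln (real N)) powr (p / real DIM('a)) = c powr (p / real DIM('a))"
proof -
  define x where "x = c * ln (real N) / real N"
  have l: "ln (real N) > 0" "real N > 0" using N by auto
  have x: "x > 0" using c l by (simp add: x_def)
  show pos: "log_radius DIM('a) c N > 0"
    unfolding log_radius_def x_def[symmetric] using x by simp
  have T: "log_radius DIM('a) c N = x powr (1 / real DIM('a))" by (simp add: log_radius_def x_def)
  have pow: "log_radius DIM('a) c N ^ k = x powr (real k / real DIM('a))" for k
    using pos by (simp add: powr_realpow[symmetric] T powr_powr)
  show "log_radius DIM('a) c N ^ DIM('a) = c * ln (real N) / real N"
    unfolding pow x_def[symmetric] using x by simp
  show "log_radius DIM('a) c N ^ (DIM('a) - 1) = (c * ln (real N) / real N) powr ((real DIM('a) - 1) / real DIM('a))"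
    unfolding pow x_def[symmetric] by (simp add: of_nat_diff Suc_leI)
  have "log_radius DIM('a) c N powr p * (real N / ln (real N)) powr (p / real DIM('a)) = (x * (real N / ln (real N))) powr (p / real DIM('a))"
    unfolding T powr_powr by (subst powr_mult) (use x l in auto)
  also have "x * (real N / ln (real N)) = c" using l by (simp add: x_def)
  finally show "log_radius DIM('a) c N powr p * (real N / ln (real N)) powr (p / real DIM('a)) = c powr (p / real DIM('a))" .
qed

lemma eventually_log_radius_less:
  assumes "c > 0" "r0 > 0"
  shows "\<forall>\<^sub>F N in sequentially. log_radius DIM('a) c N < r0"
proof -
  have "(\<lambda>N. (c * ln (real N) / real N) powr (1 / real DIM('a))) \<longlonglongrightarrow> 0"
    if "1 / real DIM('a) > 0"
    using assms(1) that by real_asymp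
  then show ?thesis
    using assms(2) order_tendstoD(2) unfolding log_radius_def by fastforce
qed

text \<open>
Both terms of the union bound are powers of \<open>N\<close> up to logarithms. For the interior term the
exponent is \<open>1 + q - 2 * \<theta> * \<kappa>\<close>, and it is negative since \<open>2 * ((d - 1) / d) \<ge> 1\<close>; this is where
\<open>d \<ge> 2\<close> is needed. The weight with exponent \<open>q\<close> is there for the moments.
\<close>
lemma prob_gt_log_radius:
  fixes P :: "nat \<Rightarrow> 'w measure"
  assumes d: "DIM('a) \<ge> 2" and iid: "\<And>N. iid_uniform_points (P N) (X N) N K"
    and c: "c > 0" and q: "q \<ge> 0"
    and \<kappa>: "(real DIM('a) - 1) / real DIM('a) + q < unit_ball_vol (real DIM('a)) * c / (2 * measure lborel K)"
  shows "(\<lambda>N. (real N / ln (real N)) powr q *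
    measure (P N) {\<omega>\<in>space (P N). log_radius DIM('a) c N < covering_radius (\<lambda>j. X N j \<omega>) N K}) \<longlonglongrightarrow> 0"
proof -
  define e where "e = (real DIM('a) - 1) / real DIM('a)"
  define \<kappa> where "\<kappa> = unit_ball_vol (real DIM('a)) * c / (2 * measure lborel K)"
  have e: "e \<ge> 1 / 2" using d by (simp add: e_def field_simps)
  have e\<kappa>: "e + q < \<kappa>" using \<kappa> by (simp add: e_def \<kappa>_def)
  define \<theta> where "\<theta> = ((e + q) / \<kappa> + 1) / 2"
  have k0: "\<kappa> > 0" using e q e\<kappa> by linarith
  have "(e + q) / \<kappa> < 1" "(e + q) / \<kappa> > 0" using e q e\<kappa> k0 by auto
  then have \<theta>01: "0 < \<theta>" "\<theta> < 1" by (auto simp: \<theta>_def)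
  have "\<theta> * \<kappa> = (e + q + \<kappa>) / 2" using k0 by (simp add: \<theta>_def field_simps)
  then have \<theta>: "0 < \<theta>" "\<theta> < 1" "e + q < \<theta> * \<kappa>" using \<theta>01 e\<kappa> by auto
  define s1 where "s1 = \<theta> * \<kappa> - (e + q)"
  define s2 where "s2 = 2 * \<theta> * \<kappa> - (1 + q)"
  have s: "s1 > 0" "s2 > 0" using \<theta> e q by (auto simp: s1_def s2_def)
  obtain C r0 where C: "C > 0" "r0 > 0" and tail:
    "\<And>(P :: 'w measure) X N r. iid_uniform_points P X N K \<Longrightarrow> N > 0 \<Longrightarrow> 0 < r \<Longrightarrow> r < r0 \<Longrightarrow>
      measure P {\<omega>\<in>space P. r < covering_radius (\<lambda>j. X j \<omega>) N K} \<le>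
        C / r ^ (DIM('a) - 1) * exp (- (\<theta> * unit_ball_vol (real DIM('a)) / 2 * r ^ DIM('a) / measure lborel K * real N)) +
        C / r ^ DIM('a) * exp (- (\<theta> * unit_ball_vol (real DIM('a)) * r ^ DIM('a) / measure lborel K * real N))"
    by (rule prob_covering_radius_gt[OF \<theta>(1,2)]) (rule that)
  let ?f = "\<lambda>e s N. (real N / ln (real N)) powr q * ((c * ln (real N) / real N) powr (- e) * exp (- ((e + q + s) * ln (real N))))"
  have "(\<lambda>N. C * ?f e s1 N + C * ?f 1 s2 N) \<longlonglongrightarrow> C * 0 + C * 0"
    by (intro tendsto_add tendsto_mult_left union_bound_asymptotics s c)
  then have lim: "(\<lambda>N. C * ?f e s1 N + C * ?f 1 s2 N) \<longlonglongrightarrow> 0" by simp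
  show ?thesis
  proof (rule tendsto_sandwich[OF _ _ tendsto_const lim])
    show "\<forall>\<^sub>F N in sequentially. (0::real) \<le> (real N / ln (real N)) powr q *
      measure (P N) {\<omega>\<in>space (P N). log_radius DIM('a) c N < covering_radius (\<lambda>j. X N j \<omega>) N K}"
      by simp
    show "\<forall>\<^sub>F N in sequentially. (real N / ln (real N)) powr q *
      measure (P N) {\<omega>\<in>space (P N). log_radius DIM('a) c N < covering_radius (\<lambda>j. X N j \<omega>) N K} \<le> C * ?f e s1 N + C * ?f 1 s2 N"
      using eventually_ge_at_top[of "2::nat"] eventually_log_radius_less[OF c C(2)]
    proof eventually_elim
      case (elim N)
      let ?r = "log_radius DIM('a) c N" and ?x = "c * ln (real N) / real N"
      have l: "ln (real N) > 0" "real N > 0" using elim by auto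
      have x: "?x > 0" using c l by simp
      have k1: "\<theta> * unit_ball_vol (real DIM('a)) / 2 * ?x / measure lborel K * real N = (e + q + s1) * ln (real N)"
        using l by (simp add: s1_def \<kappa>_def)
      have k2: "\<theta> * unit_ball_vol (real DIM('a)) * ?x / measure lborel K * real N = (1 + q + s2) * ln (real N)"
        using l by (simp add: s2_def \<kappa>_def)
      have "measure (P N) {\<omega>\<in>space (P N). ?r < covering_radius (\<lambda>j. X N j \<omega>) N K} \<le>
         C / ?r ^ (DIM('a) - 1) * exp (- (\<theta> * unit_ball_vol (real DIM('a)) / 2 * ?r ^ DIM('a) / measure lborel K * real N)) +
         C / ?r ^ DIM('a) * exp (- (\<theta> * unit_ball_vol (real DIM('a)) * ?r ^ DIM('a) / measure lborel K * real N))"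
        using elim log_radius_powers(1)[OF c, of N] by (intro tail iid) auto
      also have "\<dots> = C * (?x powr (- e) * exp (- ((e + q + s1) * ln (real N)))) + C * (?x powr (- 1) * exp (- ((1 + q + s2) * ln (real N))))"
        unfolding log_radius_powers(2,3)[OF c elim(1)] k1 k2 e_def[symmetric]
        using x by (simp add: powr_minus divide_inverse)
      finally have "(real N / ln (real N)) powr q * measure (P N) {\<omega>\<in>space (P N). ?r < covering_radius (\<lambda>j. X N j \<omega>) N K} \<le>
        (real N / ln (real N)) powr q * (C * (?x powr (- e) * exp (- ((e + q + s1) * ln (real N)))) + C * (?x powr (- 1) * exp (- ((1 + q + s2) * ln (real N)))))"
        by (rule mult_left_mono) simp
      then show ?case by (simp only: distrib_left mult.left_commute)
    qed
  qed
qed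

lemma prob_lt_log_radius:
  fixes P :: "nat \<Rightarrow> 'w measure"
  assumes iid: "\<And>N. iid_uniform_points (P N) (X N) N K"
    and c: "c > 0"
    and \<kappa>: "unit_ball_vol (real DIM('a)) * c / (2 * measure lborel K) < (real DIM('a) - 1) / real DIM('a)"
  shows "(\<lambda>N. measure (P N) {\<omega>\<in>space (P N). covering_radius (\<lambda>j. X N j \<omega>) N K < log_radius DIM('a) c N}) \<longlonglongrightarrow> 0"
proof -
  define e where "e = (real DIM('a) - 1) / real DIM('a)"
  define \<kappa> where "\<kappa> = unit_ball_vol (real DIM('a)) * c / (2 * measure lborel K)"
  have \<kappa>: "0 < \<kappa>" "\<kappa> < e" using \<kappa> c vol_pos by (auto simp: e_def \<kappa>_def unit_ball_vol_pos)
  define \<theta> where "\<theta> = (e / \<kappa> + 1) / 2"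
  have \<theta>: "\<theta> > 1" "\<theta> * \<kappa> < e" using \<kappa> by (auto simp: \<theta>_def field_simps)
  define s where "s = e - \<theta> * \<kappa>"
  have s: "s > 0" using \<theta> by (simp add: s_def)
  obtain C r0 where C: "C > 0" "r0 > 0" and tail:
    "\<And>(P :: 'w measure) X N r. iid_uniform_points P X N K \<Longrightarrow> N > 0 \<Longrightarrow> 0 < r \<Longrightarrow> r < r0 \<Longrightarrow>
      measure P {\<omega>\<in>space P. covering_radius (\<lambda>j. X j \<omega>) N K < r} \<le>
        C * r ^ (DIM('a) - 1) * exp (\<theta> * unit_ball_vol (real DIM('a)) / 2 * r ^ DIM('a) / measure lborel K * real N)"
    by (rule prob_covering_radius_lt[OF \<theta>(1)]) (rule that)
  have "(\<lambda>N. C * ((c * ln (real N) / real N) powr e * exp ((e - s) * ln (real N)))) \<longlonglongrightarrow> C * 0"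
    using s c by (intro tendsto_mult_left) real_asymp
  then have lim: "(\<lambda>N. C * ((c * ln (real N) / real N) powr e * exp ((e - s) * ln (real N)))) \<longlonglongrightarrow> 0" by simp
  show ?thesis
  proof (rule tendsto_sandwich[OF _ _ tendsto_const lim])
    show "\<forall>\<^sub>F N in sequentially. 0 \<le> measure (P N) {\<omega>\<in>space (P N). covering_radius (\<lambda>j. X N j \<omega>) N K < log_radius DIM('a) c N}"
      by simp
    show "\<forall>\<^sub>F N in sequentially. measure (P N) {\<omega>\<in>space (P N). covering_radius (\<lambda>j. X N j \<omega>) N K < log_radius DIM('a) c N}
       \<le> C * ((c * ln (real N) / real N) powr e * exp ((e - s) * ln (real N)))"
      using eventually_ge_at_top[of "2::nat"] eventually_log_radius_less[OF c C(2)]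
    proof eventually_elim
      case (elim N)
      let ?r = "log_radius DIM('a) c N" and ?x = "c * ln (real N) / real N"
      have l: "ln (real N) > 0" "real N > 0" using elim by auto
      have k: "\<theta> * unit_ball_vol (real DIM('a)) / 2 * ?x / measure lborel K * real N = (e - s) * ln (real N)"
        using l by (simp add: s_def \<kappa>_def)
      have "measure (P N) {\<omega>\<in>space (P N). covering_radius (\<lambda>j. X N j \<omega>) N K < ?r} \<le>
         C * ?r ^ (DIM('a) - 1) * exp (\<theta> * unit_ball_vol (real DIM('a)) / 2 * ?r ^ DIM('a) / measure lborel K * real N)"
        using elim log_radius_powers(1)[OF c, of N] by (intro tail iid) auto
      also have "\<dots> = C * (?x powr e * exp ((e - s) * ln (real N)))"
        unfolding log_radius_powers(2,3)[OF c elim(1)] k e_def[symmetric] by simp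
      finally show ?case .
    qed
  qed
qed

text \<open>
The constant \<open>cs\<close> is the threshold at which the expected number of empty boundary balls changes from
large to small: there the exponent \<open>v * c / (2 * H)\<close> equals \<open>e = (d - 1) / d\<close>.
\<close>
theorem covering_radius_moment_limit:
  fixes P :: "nat \<Rightarrow> 'w measure"
  assumes d: "DIM('a) \<ge> 2" and p: "p > 0" and iid: "\<And>N. iid_uniform_points (P N) (X N) N K"
  shows "(\<lambda>N. prob_space.expectation (P N) (\<lambda>\<omega>. covering_radius (\<lambda>j. X N j \<omega>) N K powr p)
      * (real N / ln (real N)) powr (p / real DIM('a)))
    \<longlonglongrightarrow> (2 * (real DIM('a) - 1) / real DIM('a) * (measure lborel K / unit_ball_vol (real DIM('a)))) powr (p / real DIM('a))"
proof -
  define n where "n = real DIM('a)"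
  define v where "v = unit_ball_vol n"
  define H where "H = measure lborel K"
  define e where "e = (n - 1) / n"
  define q where "q = p / n"
  define cs where "cs = 2 * (n - 1) / n * (H / v)"
  define E where "E = (\<lambda>N. prob_space.expectation (P N) (\<lambda>\<omega>. covering_radius (\<lambda>j. X N j \<omega>) N K powr p))"
  define a where "a = (\<lambda>N::nat. real N / ln (real N))"
  define U where "U = (\<lambda>c N. measure (P N) {\<omega>\<in>space (P N). log_radius DIM('a) c N < covering_radius (\<lambda>j. X N j \<omega>) N K})"
  define V where "V = (\<lambda>c N. measure (P N) {\<omega>\<in>space (P N). covering_radius (\<lambda>j. X N j \<omega>) N K < log_radius DIM('a) c N})"
  have n: "n \<ge> 2" using d by (simp add: n_def)
  have v: "v > 0" by (simp add: v_def unit_ball_vol_pos n_def)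
  have H: "H > 0" using vol_pos by (simp add: H_def)
  have e: "e > 0" using n by (simp add: e_def)
  have q: "q > 0" using p n by (simp add: q_def)
  have "v * cs / (2 * H) = e" using n v H by (simp add: cs_def e_def field_simps)
  moreover have "cs > 0" using n v H by (simp add: cs_def)
  ultimately have cs: "cs > 0" "v * cs / (2 * H) = e" by auto
  have mono: "v * c / (2 * H) < v * c' / (2 * H)" if "c < c'" for c c'
    using that v H by (intro divide_strict_right_mono mult_strict_left_mono) auto
  have U0: "(\<lambda>N. a N powr q' * U c N) \<longlonglongrightarrow> 0" if "c > 0" "q' \<ge> 0" "e + q' < v * c / (2 * H)" for c q'
    using prob_gt_log_radius[OF d iid that(1,2)] that(3)
    by (simp add: a_def U_def e_def v_def H_def n_def)
  have V0: "V c \<longlonglongrightarrow> 0" if "c > 0" "c < cs" for c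
    using prob_lt_log_radius[OF iid that(1)] mono[OF that(2)] cs(2)
    by (simp add: V_def e_def v_def H_def n_def)
  have ps: "prob_space (P N)" for N using iid[of N] by (simp add: iid_uniform_points_def)
  have Epow: "log_radius DIM('a) c N powr p * a N powr q = c powr q" if "c > 0" "N \<ge> 2" for c N
    using log_radius_powers(4)[OF that] by (simp add: a_def q_def n_def)
  have upper: "E N * a N powr q \<le> c powr q + c' powr q * U c N + diameter K powr p * (a N powr q * U c' N)"
    if c: "c > 0" "c' > 0" and N: "N \<ge> 2" for c c' N
  proof -
    interpret prob_space "P N" by (rule ps)
    have N0: "N > 0" using N by simp
    have "E N \<le> log_radius DIM('a) c N powr p + log_radius DIM('a) c' N powr p * U c N + diameter K powr p * U c' N"
      unfolding E_def U_def
      by (rule moment_upper[OF iid_covering_radius_bounds[OF iid compact K_ne N0]])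
        (use p log_radius_powers(1)[OF c(1) N] log_radius_powers(1)[OF c(2) N] in auto)
    then have "E N * a N powr q \<le> (log_radius DIM('a) c N powr p + log_radius DIM('a) c' N powr p * U c N + diameter K powr p * U c' N) * a N powr q"
      by (rule mult_right_mono) simp
    also have "\<dots> = log_radius DIM('a) c N powr p * a N powr q + (log_radius DIM('a) c' N powr p * a N powr q) * U c N
        + diameter K powr p * (a N powr q * U c' N)"
      by (simp add: algebra_simps)
    finally show ?thesis by (simp only: Epow[OF c(1) N] Epow[OF c(2) N])
  qed
  have lower: "c powr q * (1 - V c N) \<le> E N * a N powr q" if c: "c > 0" and N: "N \<ge> 2" for c N
  proof -
    interpret prob_space "P N" by (rule ps)
    have N0: "N > 0" using N by simp
    have "log_radius DIM('a) c N powr p * (1 - V c N) \<le> E N"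
      unfolding E_def V_def
      by (rule moment_lower[OF iid_covering_radius_bounds[OF iid compact K_ne N0]])
        (use p log_radius_powers(1)[OF c N] in auto)
    then have "log_radius DIM('a) c N powr p * (1 - V c N) * a N powr q \<le> E N * a N powr q"
      by (rule mult_right_mono) simp
    moreover have "log_radius DIM('a) c N powr p * (1 - V c N) * a N powr q = c powr q * (1 - V c N)"
      unfolding Epow[OF c N, symmetric] by (simp only: mult_ac)
    ultimately show ?thesis by (simp only:)
  qed
  have "(\<lambda>N. E N * a N powr q) \<longlonglongrightarrow> cs powr q"
  proof (rule order_tendstoI)
    fix y assume y: "cs powr q < y"
    define z where "z = (cs powr q + y) / 2"
    have z: "cs powr q < z" "z < y" using y by (auto simp: z_def)
    have z0: "z > 0" using z cs by (smt (verit) powr_ge_zero)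
    define c where "c = z powr (1 / q)"
    have cq: "c powr q = z" using z0 q by (simp add: c_def powr_powr)
    have c: "c > 0" using z0 by (simp add: c_def)
    have "c > cs"
    proof (rule ccontr)
      assume "\<not> c > cs"
      then have "c powr q \<le> cs powr q" using c q by (intro powr_mono2) auto
      then show False using cq z by simp
    qed
    then have k1: "e + 0 < v * c / (2 * H)" using mono[of cs c] cs(2) by simp
    \<comment> \<open>A constant whose tail probability beats the weight \<open>a N powr q\<close>.\<close>
    define c' where "c' = (e + q + 1) * (2 * H) / v"
    have c': "c' > 0" using e q v H by (simp add: c'_def)
    have k2: "e + q < v * c' / (2 * H)" using v H by (simp add: c'_def)
    have "\<forall>\<^sub>F N in sequentially. a N powr 0 * U c N = U c N"
      using eventually_ge_at_top[of "2::nat"]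
    proof eventually_elim
      case (elim N)
      then have "a N > 0" by (simp add: a_def)
      then show ?case by simp
    qed
    then have "U c \<longlonglongrightarrow> 0" using U0[OF c order_refl k1] by (simp only: tendsto_cong)
    moreover have "(\<lambda>N. a N powr q * U c' N) \<longlonglongrightarrow> 0" using U0[OF c' less_imp_le[OF q] k2] .
    ultimately have "(\<lambda>N. c powr q + c' powr q * U c N + diameter K powr p * (a N powr q * U c' N))
        \<longlonglongrightarrow> c powr q + c' powr q * 0 + diameter K powr p * 0"
      by (intro tendsto_add tendsto_mult_left tendsto_const)
    then have "\<forall>\<^sub>F N in sequentially. c powr q + c' powr q * U c N + diameter K powr p * (a N powr q * U c' N) < y"
      by (rule order_tendstoD(2)) (use cq z in simp)
    with eventually_ge_at_top[of "2::nat"] show "\<forall>\<^sub>F N in sequentially. E N * a N powr q < y"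
      by eventually_elim (use upper[OF c c'] in fastforce)
  next
    fix y assume y: "y < cs powr q"
    define z where "z = max ((cs powr q + y) / 2) (cs powr q / 2)"
    have cs0: "cs powr q > 0" using cs by simp
    have z: "y < z" "z < cs powr q" "z > 0" using y cs0 by (auto simp: z_def less_max_iff_disj)
    define c where "c = z powr (1 / q)"
    have cq: "c powr q = z" using z q by (simp add: c_def powr_powr)
    have c: "c > 0" using z by (simp add: c_def)
    have "c < cs"
    proof (rule ccontr)
      assume "\<not> c < cs"
      then have "cs powr q \<le> c powr q" using cs q by (intro powr_mono2) auto
      then show False using cq z by simp
    qed
    then have "V c \<longlonglongrightarrow> 0" by (rule V0[OF c])
    then have "(\<lambda>N. c powr q * (1 - V c N)) \<longlonglongrightarrow> c powr q * (1 - 0)"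
      by (intro tendsto_mult_left tendsto_diff tendsto_const)
    then have "\<forall>\<^sub>F N in sequentially. y < c powr q * (1 - V c N)"
      by (rule order_tendstoD(1)) (use cq z in simp)
    with eventually_ge_at_top[of "2::nat"] show "\<forall>\<^sub>F N in sequentially. y < E N * a N powr q"
      by eventually_elim (use lower[OF c] in fastforce)
  qed
  then show ?thesis by (simp add: E_def a_def q_def cs_def n_def v_def H_def)
qed

end

section \<open>The sphere as a twice differentiable hypersurface\<close>

text \<open>
The inversion in the unit sphere, with the value 0 at the origin; in this form it is an
involution of the whole space.
\<close>
definition inversion :: "'a::real_inner \<Rightarrow> 'a" where
  "inversion z = (1 / (z \<bullet> z)) *\<^sub>R z"

lemma inversion_inversion: "inversion (inversion z) = z"
proof (cases "z = 0")
  case False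
  then have "z \<bullet> z \<noteq> 0" by simp
  then show ?thesis by (simp add: inversion_def)
qed (simp add: inversion_def)

lemma inversion_eq_0_iff [simp]: "inversion z = 0 \<longleftrightarrow> z = 0"
  by (simp add: inversion_def)

text \<open>
The derivative at \<open>z\<close> sends \<open>v\<close> to \<open>v / |z|\<^sup>2 - 2 (z \<bullet> v) z / |z|\<^sup>4\<close>. Written as an operator it is assembled
from scalars and the rank one operator \<open>v \<mapsto> (z \<bullet> v) z\<close>, which is a bilinear composition, so that the
product rule yields the second derivative \<open>D\<close>. The translations by \<open>a\<close> and \<open>b\<close> are included because a chart
and its inverse both have this shape.
\<close>
lemma C2_on_inversion:
  fixes a b :: "'a::euclidean_space"
  shows "C2_on (- {-a}) (\<lambda>x. inversion (x + a) + b)"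
proof -
  define f' :: "'a \<Rightarrow> 'a \<Rightarrow>\<^sub>L 'a" where
    "f' = (\<lambda>z. (1 / (z \<bullet> z)) *\<^sub>R id_blinfun - (2 / (z \<bullet> z)\<^sup>2) *\<^sub>R (blinfun_scaleR_left z o\<^sub>L blinfun_inner_left z))"
  define D :: "'a \<Rightarrow> 'a \<Rightarrow> 'a \<Rightarrow>\<^sub>L 'a" where
    "D = (\<lambda>z w. (- (2 * (z \<bullet> w)) / (z \<bullet> z)\<^sup>2) *\<^sub>R id_blinfun -
       ((2 / (z \<bullet> z)\<^sup>2) *\<^sub>R ((blinfun_scaleR_left z o\<^sub>L blinfun_inner_left w) + (blinfun_scaleR_left w o\<^sub>L blinfun_inner_left z)) +
        (- (8 * (z \<bullet> w)) / (z \<bullet> z) ^ 3) *\<^sub>R (blinfun_scaleR_left z o\<^sub>L blinfun_inner_left z)))"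
  note [derivative_intros] = bounded_bilinear.FDERIV[OF bounded_bilinear_blinfun_compose]
    bounded_linear.has_derivative[OF bounded_linear_blinfun_scaleR_left]
    bounded_linear.has_derivative[OF bounded_linear_blinfun_inner_left]
  have d1: "(inversion has_derivative blinfun_apply (f' z)) (at z)" if "z \<noteq> 0" for z
  proof -
    have zz: "z \<bullet> z \<noteq> 0" using that by simp
    show ?thesis
      unfolding inversion_def[abs_def]
      by (rule derivative_eq_intros refl zz)+
        (auto simp: f'_def blinfun.bilinear_simps inner_commute zz power2_eq_square field_simps scaleR_left_distrib[symmetric] intro!: ext)
  qed
  have d2: "(f' has_derivative D z) (at z)" if "z \<noteq> 0" for z
  proof -
    have zz: "z \<bullet> z \<noteq> 0" using that by simp
    show ?thesis
      unfolding f'_def D_def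
      by (rule derivative_eq_intros refl zz power_not_zero)+
        (auto simp: inner_commute zz power2_eq_square power3_eq_cube field_simps intro!: ext)
  qed
  define f'' where "f'' = (\<lambda>z. Blinfun (D z))"
  have app: "blinfun_apply (f'' z) = D z" if "z \<noteq> 0" for z
    unfolding f''_def using has_derivative_bounded_linear[OF d2[OF that]] by (rule bounded_linear_Blinfun_apply)
  have cont: "continuous_on (- {0}) f''"
  proof (rule continuous_on_blinfun_componentwise)
    fix i :: 'a assume "i \<in> Basis"
    have "continuous_on (- {0}) (\<lambda>z. D z i)"
      unfolding D_def
      by (intro continuous_intros bounded_bilinear.continuous_on[OF bounded_bilinear_blinfun_compose]
          bounded_linear.continuous_on[OF bounded_linear_blinfun_scaleR_left]
          bounded_linear.continuous_on[OF bounded_linear_blinfun_inner_left]) auto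
    then show "continuous_on (- {0}) (\<lambda>z. blinfun_apply (f'' z) i)"
      by (rule continuous_on_cong[THEN iffD1, rotated -1]) (auto simp: app)
  qed
  show ?thesis
    unfolding C2_on_def
  proof (intro exI[of _ "\<lambda>x. f' (x + a)"] exI[of _ "\<lambda>x. f'' (x + a)"] conjI ballI)
    fix x assume "x \<in> - {-a}"
    then have xa: "x + a \<noteq> 0" by (simp add: eq_neg_iff_add_eq_0)
    have sh: "((\<lambda>x. x + a) has_derivative (\<lambda>h. h)) (at x)"
      by (auto intro!: derivative_eq_intros)
    have "((\<lambda>x. inversion (x + a)) has_derivative (\<lambda>h. blinfun_apply (f' (x + a)) h)) (at x)"
      by (rule has_derivative_compose[OF sh d1[OF xa]])
    then show "((\<lambda>x. inversion (x + a) + b) has_derivative blinfun_apply (f' (x + a))) (at x)"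
      by (simp add: has_derivative_add_const)
    have "((\<lambda>x. f' (x + a)) has_derivative (\<lambda>h. D (x + a) h)) (at x)"
      by (rule has_derivative_compose[OF sh d2[OF xa]])
    then show "((\<lambda>x. f' (x + a)) has_derivative blinfun_apply (f'' (x + a))) (at x)"
      by (simp add: app[OF xa])
  next
    show "continuous_on (- {-a}) (\<lambda>x. f'' (x + a))"
      by (rule continuous_on_compose2[OF cont]) (auto intro!: continuous_intros simp: eq_neg_iff_add_eq_0)
  qed
qed

text \<open>
Stereographic projection in the form of an inversion centred at the antipode \<open>-q\<close>: it maps the sphere
without \<open>-q\<close> onto the hyperplane of all \<open>y\<close> with \<open>q \<bullet> y = 1 / 2\<close>, and the shift by \<open>c\<close> moves that hyperplane to the origin.
\<close>
lemma sphere_C2_embedded_submanifold: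
  "C2_embedded_submanifold (DIM('a) - 1) (sphere (0::'a::euclidean_space) 1)"
  unfolding C2_embedded_submanifold_def
proof
  fix q :: 'a assume q: "q \<in> sphere 0 1"
  then have qq: "q \<bullet> q = 1" by (simp add: dot_square_norm)
  define c where "c = (1 / 2) *\<^sub>R q"
  define \<phi> where "\<phi> = (\<lambda>x. inversion (x + q) + - c)"
  define \<psi> where "\<psi> = (\<lambda>y. inversion (y + c) + - q)"
  let ?U = "- {-q}" and ?V = "- {-c}" and ?S = "{y. q \<bullet> y = 0}"
  have q0: "q \<noteq> 0" using qq by auto
  have inv: "\<psi> (\<phi> x) = x" "\<phi> (\<psi> x) = x" for x by (simp_all add: \<phi>_def \<psi>_def inversion_inversion)
  have C2: "C2_on ?U \<phi>" "C2_on ?V \<psi>" unfolding \<phi>_def \<psi>_def by (rule C2_on_inversion)+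
  have cont: "continuous_on S f" if "C2_on S f" for S and f :: "'a \<Rightarrow> 'a"
    using that unfolding C2_on_def
    by (metis continuous_at_imp_continuous_on has_derivative_continuous)
  have \<phi>V: "\<phi> x \<in> ?V" if "x \<in> ?U" for x
    using that by (simp add: \<phi>_def eq_neg_iff_add_eq_0)
  have \<psi>U: "\<psi> y \<in> ?U" if "y \<in> ?V" for y
    using that by (simp add: \<psi>_def eq_neg_iff_add_eq_0)
  have hom: "homeomorphism ?U ?V \<phi> \<psi>"
    by (intro homeomorphismI cont C2 image_subsetI \<phi>V \<psi>U inv)
  have key: "x \<in> sphere 0 1 \<longleftrightarrow> \<phi> x \<in> ?S" if x: "x \<in> ?U" for x
  proof -
    define z where "z = x + q"
    have z: "z \<bullet> z \<noteq> 0" using x by (simp add: z_def eq_neg_iff_add_eq_0)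
    have "x \<bullet> x = z \<bullet> z - 2 * (q \<bullet> z) + 1"
      using qq by (simp add: z_def inner_simps inner_commute)
    then have "x \<in> sphere 0 1 \<longleftrightarrow> z \<bullet> z = 2 * (q \<bullet> z)" by (auto simp: norm_eq_1)
    also have "\<dots> \<longleftrightarrow> (q \<bullet> z) / (z \<bullet> z) - 1 / 2 = 0" using z by (simp add: field_simps) argo
    also have "(q \<bullet> z) / (z \<bullet> z) - 1 / 2 = q \<bullet> \<phi> x"
      using qq unfolding \<phi>_def c_def inversion_def z_def[symmetric] by (simp add: inner_diff_right)
    finally have "x \<in> sphere 0 1 \<longleftrightarrow> q \<bullet> \<phi> x = 0" .
    then show ?thesis by simp
  qed
  have img: "\<phi> ` (?U \<inter> sphere 0 1) = ?V \<inter> ?S"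
  proof (intro equalityI subsetI)
    fix y assume "y \<in> \<phi> ` (?U \<inter> sphere 0 1)"
    then show "y \<in> ?V \<inter> ?S" using key \<phi>V by auto
  next
    fix y assume y: "y \<in> ?V \<inter> ?S"
    then show "y \<in> \<phi> ` (?U \<inter> sphere 0 1)"
      using key[of "\<psi> y"] \<psi>U[of y] inv by (intro image_eqI[where x = "\<psi> y"]) auto
  qed
  have "q \<noteq> - q" using q0 by (simp add: eq_neg_iff_add_eq_0 scaleR_2[symmetric])
  then have qU: "q \<in> ?U" by simp
  have opn: "open ?U" "open ?V" by (auto simp: open_Compl)
  show "\<exists>(U :: 'a set) (V :: 'a set) \<phi> \<psi> S. open U \<and> open V \<and> q \<in> U \<and>
        homeomorphism U V \<phi> \<psi> \<and> C2_on U \<phi> \<and> C2_on V \<psi> \<and>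
        subspace S \<and> dim S = DIM('a) - 1 \<and> \<phi> ` (U \<inter> sphere 0 1) = V \<inter> S"
    by (intro exI[of _ ?U] exI[of _ ?V] exI[of _ \<phi>] exI[of _ \<psi>] exI[of _ ?S] conjI
        opn qU hom C2 subspace_hyperplane dim_hyperplane[OF q0] img)
qed

section \<open>Covering radius of random points in smooth bodies and in the unit ball\<close>

theorem theorem3p7:
  fixes p :: real
  assumes "CARD('n::finite) \<ge> 2" and "p \<ge> 1"
  shows
   "(\<forall>(K :: (real ^ 'n) set) (P :: nat \<Rightarrow> 'w measure) (X :: nat \<Rightarrow> nat \<Rightarrow> 'w \<Rightarrow> real ^ 'n).
       compact K \<and> 0 < emeasure lborel K \<and> emeasure lborel K < \<infinity> \<and>
       (\<exists>K0. open K0 \<and> K = closure K0 \<and> frontier K0 = frontier K) \<and>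
       C2_embedded_submanifold (CARD('n) - 1) (frontier K) \<and>
       (\<forall>N. iid_uniform_points (P N) (X N) N K)
       \<longrightarrow>
       (\<lambda>N. prob_space.expectation (P N) (\<lambda>\<omega>. covering_radius (\<lambda>j. X N j \<omega>) N K powr p)
             * (real N / ln (real N)) powr (p / real CARD('n)))
       \<longlonglongrightarrow> (2 * (real CARD('n) - 1) / real CARD('n)
              * (measure lborel K / unit_ball_vol (real CARD('n)))) powr (p / real CARD('n)))
    \<and>
    (\<forall>(P :: nat \<Rightarrow> 'w measure) (X :: nat \<Rightarrow> nat \<Rightarrow> 'w \<Rightarrow> real ^ 'n).
       (\<forall>N. iid_uniform_points (P N) (X N) N (cball 0 1))
       \<longrightarrow>
       (\<lambda>N. prob_space.expectation (P N) (\<lambda>\<omega>. covering_radius (\<lambda>j. X N j \<omega>) N (cball 0 1) powr p)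
             * (real N / ln (real N)) powr (p / real CARD('n)))
       \<longlonglongrightarrow> (2 * (real CARD('n) - 1) / real CARD('n)) powr (p / real CARD('n)))"
proof -
  have dim: "DIM(real ^ 'n) = CARD('n)" by simp
  have gen: "(\<lambda>N. prob_space.expectation (P N) (\<lambda>\<omega>. covering_radius (\<lambda>j. X N j \<omega>) N K powr p)
             * (real N / ln (real N)) powr (p / real CARD('n)))
       \<longlonglongrightarrow> (2 * (real CARD('n) - 1) / real CARD('n)
              * (measure lborel K / unit_ball_vol (real CARD('n)))) powr (p / real CARD('n))"
    if "compact K" "0 < emeasure lborel K" "\<exists>K0. open K0 \<and> K = closure K0 \<and> frontier K0 = frontier K"
      "C2_embedded_submanifold (CARD('n) - 1) (frontier K)" and iid: "\<And>N. iid_uniform_points (P N) (X N) N K"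
    for K :: "(real ^ 'n) set" and P :: "nat \<Rightarrow> 'w measure" and X :: "nat \<Rightarrow> nat \<Rightarrow> 'w \<Rightarrow> real ^ 'n"
  proof -
    interpret smooth_body K by unfold_locales (use that in simp_all)
    show ?thesis
      using covering_radius_moment_limit[of p P X, OF _ _ iid] assms unfolding dim by simp
  qed
  have ball: "compact (cball 0 1 :: (real ^ 'n) set)" "0 < emeasure lborel (cball 0 1 :: (real ^ 'n) set)"
    "\<exists>K0 :: (real ^ 'n) set. open K0 \<and> cball 0 1 = closure K0 \<and> frontier K0 = frontier (cball 0 1)"
    "C2_embedded_submanifold (CARD('n) - 1) (frontier (cball 0 1 :: (real ^ 'n) set))"
  proof -
    show "0 < emeasure lborel (cball 0 1 :: (real ^ 'n) set)"
      by (simp add: emeasure_cball unit_ball_vol_pos)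
    show "\<exists>K0 :: (real ^ 'n) set. open K0 \<and> cball 0 1 = closure K0 \<and> frontier K0 = frontier (cball 0 1)"
      by (intro exI[of _ "ball 0 1"]) simp
    show "C2_embedded_submanifold (CARD('n) - 1) (frontier (cball 0 1 :: (real ^ 'n) set))"
      using sphere_C2_embedded_submanifold[where 'a = "real ^ 'n"] by simp
  qed simp
  have vol: "measure lborel (cball 0 1 :: (real ^ 'n) set) / unit_ball_vol (real CARD('n)) = 1"
    by (simp add: content_cball unit_ball_vol_pos less_imp_neq[symmetric])
  show ?thesis
    using gen gen[OF ball] unfolding vol by (intro conjI allI impI) simp_all
qed

end
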